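(* Let $Z_\infty=(Y_\infty,\zeta)$ be a random element of $S=C_{00}[0,1]\times\mathbb{R}$ whose distribution is the unique fixed point in $\mathcal{M}$ of the operator $\Psi:\mathcal{M}\to\mathcal{M}$ (equivalently, $Z_\infty$ is the limit in distribution of $(Y^\circ(T_n),\eta^\circ(T_n))$ as $n\to\infty$ for a BST sequence $(T_n)_{n\in\mathbb{N}}$). Then $$P\left(\sup_{0\le s<t\le1}\frac{|Y_\infty(t)-Y_\infty(s)|}{|t-s|}=\infty\right)=1$$ and, for all $\alpha<1$, $$P\left(\sup_{0\le s<t\le1}\frac{|Y_\infty(t)-Y_\infty(s)|}{|t-s|^\alpha}<\infty\right)=1.$$
   Context: Space: $S:=C_{00}[0,1]\times\mathbb{R}$, where $C_{00}[0,1]$ is the set of continuous $f:[0,1]\to\mathbb{R}$ with $f(0)=f(1)=0$, with norm $\|(f,a)\|:=\|f\|_\infty+|a|$. $\mathcal{M}$ is the set of probability measures $\mu$ on the Borel subsets of $S$ with $\int(\|f\|_\infty^2+x^2)\,\mu(df,dx)<\infty$ and $\int x\,\mu(df,dx)=0$. Linear operators on $C_{00}[0,1]$: $Af(t):=\frac12f(2t\wedge1)$, $Bf(t):=\frac12f((2t-1)^+)$; $\phi(t):=\frac12(t\wedge(1-t))$ for $0\le t\le1$. Operator $\Psi$: for $\mu\in\mathcal{M}$, $\Psi(\mu)\in\mathcal{M}$ is the joint distribution of the random function $AY+BY'+(\eta-\eta')\phi+(\log\xi-\log(1-\xi))\phi$ and the real random variable $1+\frac12(\eta+\eta')+\frac12(\log\xi+\log(1-\xi))$,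 where $(Y,\eta)$, $(Y',\eta')$ and $\xi$ are independent, $(Y,\eta)\sim\mu$, $(Y',\eta')\sim\mu$, and $\xi$ is uniformly distributed on $(0,1)$. It is known (an earlier theorem) that $\Psi$ has a unique fixed point in $\mathcal{M}$ and that it is the limit distribution of $(Y^\circ(T_n),\eta^\circ(T_n))$, defined as follows. Nodes are the finite words over $\{0,1\}$, including the empty word (the root); a binary tree is a finite prefix-stable set $T$ of nodes; $\#T$ is its number of nodes. BST sequence: let $(\xi_n)_{n\in\mathbb{N}}$ be independent and uniformly distributed on the unit interval. $T_1$ consists only of the root, with label $\xi_1$. Given $T_n$ with its labels, start at the root; at a node $u\in T_n$ move to $(u,0)$ if $\xi_{n+1}$ is smaller than the label of $u$ and to $(u,1)$ if it is greater; the first node reached that is not in $T_n$ is added, with label $\xi_{n+1}$, to give $T_{n+1}$. Silhouette: for $s\in[0,1]$ with binary expansion $s=\sum_{k\ge1}u_k2^{-k}$ (for binary rationals $s<1$ take the expansion with $u_k=0$ for all large $k$; for $s=1$ all $u_k=1$), $X_s(T):=\min\{k\in\mathbb{N}_0:(u_1,\ldots,u_k)\notin T\}$. Then $Y_t(T):=\int_0^tX_s(T)\,ds$, $Y^\circ_t(T):=Y_t(T)-tY_1(T)$ for $t\in[0,1]$, $\eta(T):=Y_1(T)$ and $\eta^\circ(T):=\eta(T)-H(\#T)$ with $H(n)=\sum_{i=1}^n1/i$. *)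

theory Defs
  imports "HOL-Probability.Probability"
begin

text \<open>
  Continuous functions on the unit interval that vanish at both endpoints are represented by their
  extension by zero to the real line. The extension is an isometry for the supremum norms, so the
  norm of the ambient type of bounded continuous functions is the supremum norm on the interval.
\<close>

definition C00 :: "(real \<Rightarrow>\<^sub>C real) set" where
  "C00 = {f. \<forall>t. t \<le> 0 \<or> 1 \<le> t \<longrightarrow> apply_bcontfun f t = 0}"

text \<open>
  The measurable space \<open>C00 \<times> \<real>\<close>. The topology of the product type is the one induced by the norm
  \<open>\<parallel>f\<parallel> + \<bar>a\<bar>\<close>, and the trace of its Borel sets is the Borel algebra of the subspace.
\<close>

definition S_borel :: "((real \<Rightarrow>\<^sub>C real) \<times> real) measure" where
  "S_borel = restrict_space borel (C00 \<times> UNIV)"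

definition M_set :: "((real \<Rightarrow>\<^sub>C real) \<times> real) measure set" where
  "M_set = {\<mu>. prob_space \<mu> \<and> sets \<mu> = sets S_borel
      \<and> (\<integral>\<^sup>+ (f, x). ennreal ((norm f)\<^sup>2 + x\<^sup>2) \<partial>\<mu>) < \<infinity>
      \<and> (\<integral> (f, x). x \<partial>\<mu>) = 0}"

text \<open>
  On \<open>C00\<close> the formulas for the two operators also give the value zero outside the unit interval,
  so no case distinction is needed; for \<open>phi\<close> the zero extension is the outer maximum.
\<close>

definition opA :: "(real \<Rightarrow>\<^sub>C real) \<Rightarrow> (real \<Rightarrow>\<^sub>C real)" where
  "opA f = Bcontfun (\<lambda>t. 1/2 * apply_bcontfun f (min (2 * t) 1))"

definition opB :: "(real \<Rightarrow>\<^sub>C real) \<Rightarrow> (real \<Rightarrow>\<^sub>C real)" where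
  "opB f = Bcontfun (\<lambda>t. 1/2 * apply_bcontfun f (max (2 * t - 1) 0))"

definition phi :: "real \<Rightarrow>\<^sub>C real" where
  "phi = Bcontfun (\<lambda>t. max 0 (1/2 * min t (1 - t)))"

text \<open>The functions under \<open>Bcontfun\<close> are bounded and continuous.\<close>

lemma bcontfun_comp_half:
  fixes f :: "real \<Rightarrow>\<^sub>C real" and h :: "real \<Rightarrow> real"
  assumes "continuous_on UNIV h"
  shows "(\<lambda>t. 1/2 * apply_bcontfun f (h t)) \<in> bcontfun"
proof (rule bcontfun_normI)
  have "continuous_on UNIV (\<lambda>t. apply_bcontfun f (h t))"
    by (rule continuous_on_compose2[OF continuous_on_apply_bcontfun assms]) auto
  then show "continuous_on UNIV (\<lambda>t. 1/2 * apply_bcontfun f (h t))"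
    by (rule continuous_on_mult_left)
  show "norm (1/2 * apply_bcontfun f (h t)) \<le> 1/2 * norm f" for t
    using norm_bounded[of f "h t"] by (simp add: abs_mult)
qed

lemma apply_opA: "apply_bcontfun (opA f) t = 1/2 * apply_bcontfun f (min (2 * t) 1)"
  unfolding opA_def
  by (subst Bcontfun_inverse) (intro bcontfun_comp_half continuous_intros refl)+

lemma apply_opB: "apply_bcontfun (opB f) t = 1/2 * apply_bcontfun f (max (2 * t - 1) 0)"
  unfolding opB_def
  by (subst Bcontfun_inverse) (intro bcontfun_comp_half continuous_intros refl)+

lemma apply_phi: "apply_bcontfun phi t = max 0 (1/2 * min t (1 - t))"
proof -
  have "(\<lambda>t::real. max 0 (1/2 * min t (1 - t))) \<in> bcontfun"
  proof (rule bcontfun_normI)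
    show "continuous_on UNIV (\<lambda>t::real. max 0 (1/2 * min t (1 - t)))"
      by (intro continuous_intros)
    show "norm (max 0 (1/2 * min t (1 - t))) \<le> 1" for t :: real
      by (auto simp: max_def min_def)
  qed
  then show ?thesis
    by (simp add: phi_def Bcontfun_inverse)
qed

lemma opA_C00: "f \<in> C00 \<Longrightarrow> opA f \<in> C00"
  by (auto simp: C00_def apply_opA min_def)

lemma opB_C00: "f \<in> C00 \<Longrightarrow> opB f \<in> C00"
  by (auto simp: C00_def apply_opB max_def)

lemma phi_C00: "phi \<in> C00"
  by (auto simp: C00_def apply_phi max_def min_def)

definition Psi ::
  "((real \<Rightarrow>\<^sub>C real) \<times> real) measure \<Rightarrow> ((real \<Rightarrow>\<^sub>C real) \<times> real) measure" where
  "Psi \<mu> = distr (\<mu> \<Otimes>\<^sub>M \<mu> \<Otimes>\<^sub>M uniform_measure lborel {0<..<1::real}) S_borel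
     (\<lambda>((y, \<eta>), (y', \<eta>'), \<xi>).
        (opA y + opB y' + (\<eta> - \<eta>') *\<^sub>R phi + (ln \<xi> - ln (1 - \<xi>)) *\<^sub>R phi,
         1 + 1/2 * (\<eta> + \<eta>') + 1/2 * (ln \<xi> + ln (1 - \<xi>))))"

end

theory Submission
  imports Defs
begin

text \<open>
  The fixed point equation says that a path with law \<open>\<mu>\<close> arises by gluing two rescaled independent
  copies and adding a tent \<open>D \<cdot> phi\<close>, where \<open>D = \<eta> - \<eta>' + log \<xi> - log (1 - \<xi>)\<close>. Rescaling halves time
  and space, so it preserves slopes; the tent adds \<open>D/2\<close> to all slopes on the left half and
  subtracts \<open>D/2\<close> on the right half.

  Hoelder continuity. The real component satisfies \<open>\<eta> = (\<eta>\<^sub>1 + \<eta>\<^sub>2)/2 + toll\<close> in law. If the left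
  side exceeds \<open>x\<close> in absolute value, then the toll exceeds \<open>x/8\<close>, or both copies exceed \<open>x/4\<close>, or
  one of them exceeds \<open>3x/2\<close> in absolute value. Since \<open>(3/2)\<^sup>2 > 2\<close>, this inequality doubles any polynomial decay rate of at least
  two (\<open>quadratic_bootstrap\<close>), and finite second moments start the induction; hence \<open>\<eta>\<close> and \<open>D\<close> have
  tails that decay faster than every power. For \<open>0 < \<alpha> < 1\<close>
  put \<open>a = 2 powr (-\<alpha>)\<close>, so that \<open>1/2 < a < 1\<close>, and let \<open>q\<^sub>m K\<close> be
  the probability that some dyadic increment of some level \<open>n \<le> m\<close> exceeds \<open>K a\<^sup>n\<close>. One step of the
  recursion gives \<open>q\<^sub>m\<^sub>+\<^sub>1 K \<le> 2 q\<^sub>m (\<rho> K) + P (\<bar>D\<bar> > c K)\<close> with some \<open>\<rho> > 1\<close>, \<open>c > 0\<close>, and \<open>q\<^sub>0 = 0\<close>.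
  Therefore \<open>q\<^sub>m K\<close> is bounded by a negative power of \<open>K\<close> uniformly in \<open>m\<close>
  (\<open>dyadic_failure_bound\<close>), and chaining turns dyadic bounds into Hoelder bounds
  (\<open>dyadic_imp_hoelder\<close>).

  No Lipschitz bound. A glued path is Lipschitz only if both copies are, so the probability \<open>p\<close> of
  being Lipschitz satisfies \<open>p \<le> p\<^sup>2\<close>, and \<open>p\<close> is 0 or 1. If \<open>p = 1\<close>, the largest slope \<open>M\<close> is
  almost surely finite, and the glued path satisfies \<open>M \<ge> M\<^sub>I + \<Delta>\<close>, where the half \<open>I\<close> is chosen
  as the left one exactly if \<open>\<xi> > 1/2\<close>, and where \<open>\<Delta>\<close> is integrable with expectation
  \<open>1/8\<close>. But \<open>M\<close> and \<open>M\<^sub>I\<close> have the same law, so truncating both and letting the truncation level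
  tend to infinity gives \<open>E \<Delta> \<le> 0\<close> (\<open>prob_lipschitz\<close>), a contradiction.
\<close>

section \<open>Measurable maps into the path space\<close>

lemma C00_add: "f \<in> C00 \<Longrightarrow> g \<in> C00 \<Longrightarrow> f + g \<in> C00"
  by (auto simp: C00_def)

lemma C00_scaleR: "f \<in> C00 \<Longrightarrow> c *\<^sub>R f \<in> C00"
  by (auto simp: C00_def)

lemma C00_of_int:
  assumes "f \<in> C00"
  shows "apply_bcontfun f (of_int j) = 0"
proof -
  have "of_int j \<le> (0::real) \<or> 1 \<le> (of_int j :: real)" by (cases "j \<le> 0") auto
  then show ?thesis using assms unfolding C00_def by blast
qed

lemma continuous_on_eval: "continuous_on UNIV (\<lambda>f :: real \<Rightarrow>\<^sub>C real. apply_bcontfun f t)"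
proof -
  have "bounded_linear (\<lambda>f :: real \<Rightarrow>\<^sub>C real. apply_bcontfun f t)"
    by (rule bounded_linear_intro[where K=1])
       (use norm_bounded[of _ t] in \<open>auto simp flip: real_norm_def\<close>)
  then show ?thesis by (rule linear_continuous_on)
qed

lemma space_S_borel: "space S_borel = C00 \<times> UNIV"
  by (simp add: S_borel_def space_restrict_space)

lemma measurable_S_borel_continuous:
  "continuous_on UNIV h \<Longrightarrow> h \<in> borel_measurable S_borel"
  unfolding S_borel_def
  by (rule measurable_restrict_space1) (rule borel_measurable_continuous_onI)

lemma measurable_eval [measurable]: "(\<lambda>z. apply_bcontfun (fst z) t) \<in> borel_measurable S_borel"
  by (rule measurable_S_borel_continuous)
     (rule continuous_on_compose2[OF continuous_on_eval], auto intro: continuous_intros)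

lemma measurable_snd_S_borel [measurable]: "snd \<in> borel_measurable S_borel"
  by (rule measurable_S_borel_continuous) (intro continuous_intros)

text \<open>
  Bernstein polynomials, constant outside the unit interval. Paths are approximated by combinations
  of these fixed functions with real random coefficients: the type of bounded continuous functions is
  not second countable, so sums of measurable functions into it are not measurable for free.
\<close>

definition bernstein_clamped :: "nat \<Rightarrow> nat \<Rightarrow> (real \<Rightarrow>\<^sub>C real)" where
  "bernstein_clamped n k = Bcontfun (\<lambda>x. Bernstein n k (max 0 (min 1 x)))"

lemma apply_bernstein_clamped:
  "apply_bcontfun (bernstein_clamped n k) x = Bernstein n k (max 0 (min 1 x))"
proof -
  have "continuous_on {0..1} (Bernstein n k)"
    unfolding Bernstein_def by (intro continuous_intros)
  then have "bounded (Bernstein n k ` {0..1})"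
    by (intro compact_imp_bounded compact_continuous_image) auto
  then obtain B where B: "\<And>x. x \<in> {0..1} \<Longrightarrow> \<bar>Bernstein n k x\<bar> \<le> B"
    unfolding bounded_iff by fastforce
  have "(\<lambda>x. Bernstein n k (max 0 (min 1 x))) \<in> bcontfun"
  proof (rule bcontfun_normI)
    show "continuous_on UNIV (\<lambda>x. Bernstein n k (max 0 (min 1 x)))"
      unfolding Bernstein_def by (intro continuous_intros)
    show "norm (Bernstein n k (max 0 (min 1 x))) \<le> B" for x
      using B[of "max 0 (min 1 x)"] by simp
  qed
  then show ?thesis by (simp add: bernstein_clamped_def Bcontfun_inverse)
qed

lemma apply_sum_bcontfun:
  "apply_bcontfun (\<Sum>k\<in>A. g k) x = (\<Sum>k\<in>A. apply_bcontfun (g k) x)"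
  for g :: "'b \<Rightarrow> (real \<Rightarrow>\<^sub>C real)"
proof (cases "finite A")
  case True
  then show ?thesis
    by (induction A) auto
qed simp

lemma bernstein_clamped_tendsto:
  assumes "f \<in> C00"
  shows "(\<lambda>n. \<Sum>k\<le>n. apply_bcontfun f (k/n) *\<^sub>R bernstein_clamped n k) \<longlonglongrightarrow> f"
proof (rule LIMSEQ_I)
  fix e :: real assume e: "0 < e"
  then have "0 < e/2" by simp
  from Bernstein_Weierstrass[OF continuous_on_apply_bcontfun[of "{0..1}" f] this]
  obtain N where N: "\<And>n x. N \<le> n \<Longrightarrow> x \<in> {0..1} \<Longrightarrow>
      \<bar>apply_bcontfun f x - (\<Sum>k\<le>n. apply_bcontfun f (k/n) * Bernstein n k x)\<bar> < e/2" by blast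
  show "\<exists>no. \<forall>n\<ge>no. norm ((\<Sum>k\<le>n. apply_bcontfun f (k/n) *\<^sub>R bernstein_clamped n k) - f) < e"
  proof (intro exI allI impI)
    fix n assume n: "N \<le> n"
    have "norm ((\<Sum>k\<le>n. apply_bcontfun f (k/n) *\<^sub>R bernstein_clamped n k) - f) \<le> e/2"
    proof (rule norm_bound)
      fix x
      have fx: "apply_bcontfun f x = apply_bcontfun f (max 0 (min 1 x))"
        using assms by (auto simp: C00_def max_def min_def)
      have "\<bar>(\<Sum>k\<le>n. apply_bcontfun f (k/n) * Bernstein n k (max 0 (min 1 x)))
          - apply_bcontfun f (max 0 (min 1 x))\<bar> \<le> e/2"
        using N[OF n, of "max 0 (min 1 x)"] by (simp add: abs_minus_commute)
      then show "norm (apply_bcontfun ((\<Sum>k\<le>n. apply_bcontfun f (k/n) *\<^sub>R bernstein_clamped n k) - f) x) \<le> e/2"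
        by (simp add: apply_sum_bcontfun apply_bernstein_clamped flip: fx)
    qed
    then show "norm ((\<Sum>k\<le>n. apply_bcontfun f (k/n) *\<^sub>R bernstein_clamped n k) - f) < e" using e by simp
  qed
qed

text \<open>
  On the separable space \<open>C00\<close> the Borel algebra is generated by the evaluation maps. The proof writes
  the map as a pointwise limit of continuous functions of its values at countably many points.
\<close>

lemma measurable_S_borelI:
  fixes F :: "'b \<Rightarrow> (real \<Rightarrow>\<^sub>C real)"
  assumes C00: "\<And>\<omega>. \<omega> \<in> space M \<Longrightarrow> F \<omega> \<in> C00"
    and ev: "\<And>t. (\<lambda>\<omega>. apply_bcontfun (F \<omega>) t) \<in> borel_measurable M"
    and x: "x \<in> borel_measurable M"
  shows "(\<lambda>\<omega>. (F \<omega>, x \<omega> :: real)) \<in> measurable M S_borel"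
  unfolding S_borel_def
proof (rule measurable_restrict_space2)
  show "(\<lambda>\<omega>. (F \<omega>, x \<omega>)) \<in> borel_measurable M"
  proof (rule borel_measurable_LIMSEQ_metric)
    fix n :: nat
    have c: "(\<lambda>\<omega>. \<lambda>k. apply_bcontfun (F \<omega>) (real k / real n)) \<in> borel_measurable M"
      by (rule measurable_coordinatewise_then_product) (rule ev)
    have "continuous_on UNIV (\<lambda>(c :: nat \<Rightarrow> real, y :: real).
        (\<Sum>k\<le>n. c k *\<^sub>R bernstein_clamped n k, y))"
      unfolding case_prod_beta
      by (intro continuous_intros continuous_on_product_then_coordinatewise)
    from borel_measurable_continuous_on[OF this borel_measurable_Pair[OF c x]]
    show "(\<lambda>\<omega>. (\<Sum>k\<le>n. apply_bcontfun (F \<omega>) (real k / real n) *\<^sub>R bernstein_clamped n k, x \<omega>))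
        \<in> borel_measurable M" by simp
  next
    fix \<omega> assume "\<omega> \<in> space M"
    show "(\<lambda>n. (\<Sum>k\<le>n. apply_bcontfun (F \<omega>) (real k / real n) *\<^sub>R bernstein_clamped n k, x \<omega>))
        \<longlonglongrightarrow> (F \<omega>, x \<omega>)"
      by (intro tendsto_Pair bernstein_clamped_tendsto C00 tendsto_const) fact
  qed
qed (use C00 in auto)


section \<open>The recursion map\<close>

type_synonym point = "(real \<Rightarrow>\<^sub>C real) \<times> real"

text \<open>
  The independent ingredients \<open>((Y, \<eta>), (Y', \<eta>'), \<xi>)\<close> of one step of the recursion.
\<close>

type_synonym innovation = "point \<times> point \<times> real"

text \<open>
  The random factor of the tent function \<open>phi\<close>. As \<open>phi\<close> has slopes \<open>1/2\<close> and \<open>-1/2\<close>, half of it is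
  added to the slopes on the left and subtracted on the right.
\<close>

definition drift :: "innovation \<Rightarrow> real" where
  "drift q = snd (fst q) - snd (fst (snd q)) + (ln (snd (snd q)) - ln (1 - snd (snd q)))"

text \<open>
  The path component of one step of the recursion.
\<close>

definition glue :: "innovation \<Rightarrow> real \<Rightarrow>\<^sub>C real" where
  "glue q = opA (fst (fst q)) + opB (fst (fst (snd q))) + drift q *\<^sub>R phi"

text \<open>
  The part of the new real component that depends only on \<open>\<xi>\<close>.
\<close>

definition toll :: "real \<Rightarrow> real" where
  "toll \<xi> = 1 + 1/2 * (ln \<xi> + ln (1 - \<xi>))"

text \<open>
  One step of the recursion: the map whose image of the product law defines the operator.
\<close>

definition recur :: "innovation \<Rightarrow> point" where
  "recur q = (glue q, (snd (fst q) + snd (fst (snd q))) / 2 + toll (snd (snd q)))"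

abbreviation unif :: "real measure" where
  "unif \<equiv> uniform_measure lborel {0<..<1}"

lemma Psi_eq_distr_recur: "Psi \<mu> = distr (\<mu> \<Otimes>\<^sub>M \<mu> \<Otimes>\<^sub>M unif) S_borel recur"
  unfolding Psi_def
  by (rule arg_cong[where f="distr _ _"])
     (auto simp: recur_def glue_def drift_def toll_def fun_eq_iff algebra_simps scaleR_diff_left scaleR_add_left add_divide_distrib)

lemma measurable_recur:
  assumes [measurable_cong]: "sets \<mu> = sets S_borel"
  shows "recur \<in> measurable (\<mu> \<Otimes>\<^sub>M \<mu> \<Otimes>\<^sub>M unif) S_borel"
proof -
  have sp: "space \<mu> = C00 \<times> UNIV"
    using sets_eq_imp_space_eq[OF assms] by (simp add: space_S_borel)
  have [measurable]: "(\<lambda>z. apply_bcontfun (fst z) t) \<in> borel_measurable \<mu>" for t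
    using measurable_eval measurable_cong_sets[OF assms refl] by blast
  have [measurable]: "snd \<in> borel_measurable \<mu>"
    using measurable_snd_S_borel measurable_cong_sets[OF assms refl] by blast
  have [measurable]: "(\<lambda>q. apply_bcontfun (glue q) t) \<in> borel_measurable (\<mu> \<Otimes>\<^sub>M \<mu> \<Otimes>\<^sub>M unif)" for t
    unfolding glue_def drift_def plus_bcontfun.rep_eq scaleR_bcontfun.rep_eq apply_opA apply_opB
    by measurable
  show ?thesis
    unfolding recur_def
  proof (rule measurable_S_borelI)
    fix q assume "q \<in> space (\<mu> \<Otimes>\<^sub>M \<mu> \<Otimes>\<^sub>M unif)"
    then show "glue q \<in> C00"
      by (auto simp: glue_def space_pair_measure sp intro!: C00_add C00_scaleR opA_C00 opB_C00 phi_C00)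
  qed (simp_all add: toll_def, measurable)
qed

lemma glue_left:
  assumes "fst (fst q) \<in> C00" "fst (fst (snd q)) \<in> C00" "s \<le> 1/2"
  shows "apply_bcontfun (glue q) s
    = 1/2 * apply_bcontfun (fst (fst q)) (2 * s) + drift q * apply_bcontfun phi s"
  using assms by (simp add: glue_def apply_opA apply_opB
      max_def min_def C00_def)

lemma glue_right:
  assumes "fst (fst q) \<in> C00" "fst (fst (snd q)) \<in> C00" "1/2 \<le> s"
  shows "apply_bcontfun (glue q) s
    = 1/2 * apply_bcontfun (fst (fst (snd q))) (2 * s - 1) + drift q * apply_bcontfun phi s"
  using assms by (auto simp: glue_def apply_opA apply_opB
      max_def min_def C00_def)

lemma phi_lipschitz: "\<bar>apply_bcontfun phi s - apply_bcontfun phi t\<bar> \<le> \<bar>s - t\<bar> / 2"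
  unfolding apply_phi max_def min_def abs_if by (simp add: field_simps)

section \<open>Hoelder bounds and dyadic increments\<close>

text \<open>
  The increments over dyadic intervals of level \<open>n \<le> m\<close> are at most \<open>K a\<^sup>n\<close>; for \<open>a = 2 powr (-\<alpha>)\<close>
  this is the Hoelder condition of exponent \<open>\<alpha>\<close> for these intervals. The index \<open>k\<close> ranges over all
  integers, which does not change the condition for functions that vanish outside the unit interval.
\<close>

definition dyadic_bounded :: "real \<Rightarrow> nat \<Rightarrow> real \<Rightarrow> (real \<Rightarrow>\<^sub>C real) \<Rightarrow> bool" where
  "dyadic_bounded a m K f \<longleftrightarrow> (\<forall>n\<le>m. \<forall>k::int.
     \<bar>apply_bcontfun f ((of_int k + 1) / 2 ^ n) - apply_bcontfun f (of_int k / 2 ^ n)\<bar> \<le> K * a ^ n)"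

text \<open>
  Hoelder continuity on the unit interval with exponent \<open>\<alpha>\<close> and constant \<open>K\<close>.
\<close>

definition hoelder_bounded :: "real \<Rightarrow> real \<Rightarrow> (real \<Rightarrow>\<^sub>C real) \<Rightarrow> bool" where
  "hoelder_bounded \<alpha> K f \<longleftrightarrow> (\<forall>s t. 0 \<le> s \<longrightarrow> s < t \<longrightarrow> t \<le> 1 \<longrightarrow>
     \<bar>apply_bcontfun f t - apply_bcontfun f s\<bar> \<le> K * \<bar>t - s\<bar> powr \<alpha>)"

lemma dyadic_bounded_antimono: "m \<le> n \<Longrightarrow> dyadic_bounded a n K f \<Longrightarrow> dyadic_bounded a m K f"
  unfolding dyadic_bounded_def by (meson order.trans)

lemma dyadic_step:
  fixes x :: real
  shows "\<exists>d\<in>{0,1::int}. \<lfloor>x * 2 ^ Suc n\<rfloor> = 2 * \<lfloor>x * 2 ^ n\<rfloor> + d"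
proof -
  define k where "k = \<lfloor>x * 2 ^ n\<rfloor>"
  have "of_int k \<le> x * 2 ^ n" "x * 2 ^ n < of_int k + 1"
    unfolding k_def by linarith+
  then have "2 * k \<le> \<lfloor>x * 2 ^ Suc n\<rfloor>" "\<lfloor>x * 2 ^ Suc n\<rfloor> < 2 * k + 2"
    by (simp_all add: le_floor_iff floor_less_iff field_simps)
  then have "\<lfloor>x * 2 ^ Suc n\<rfloor> - 2 * k \<in> {0,1}" by auto
  then show ?thesis unfolding k_def by (intro bexI[where x="\<lfloor>x * 2 ^ Suc n\<rfloor> - 2 * k"]) (auto simp: k_def)
qed

text \<open>
  Chaining: \<open>x\<close> is the limit of its dyadic roundings, and each refinement of the rounding moves by at
  most one dyadic interval of the finer level.
\<close>

lemma dyadic_tail_bound: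
  fixes f :: "real \<Rightarrow>\<^sub>C real"
  assumes f: "\<And>m. dyadic_bounded a m K f" and a: "0 < a" "a < 1" and K: "0 \<le> K"
  shows "\<bar>apply_bcontfun f x - apply_bcontfun f (of_int \<lfloor>x * 2 ^ n\<rfloor> / 2 ^ n)\<bar> \<le> K * a ^ Suc n / (1 - a)"
proof -
  define r where "r n = of_int \<lfloor>x * 2 ^ n\<rfloor> / (2 ^ n :: real)" for n :: nat
  have step: "\<bar>apply_bcontfun f (r (Suc m)) - apply_bcontfun f (r m)\<bar> \<le> K * a ^ Suc m" for m
  proof -
    define k where "k = \<lfloor>x * 2 ^ m\<rfloor>"
    obtain d where d: "d \<in> {0,1}" and eq: "\<lfloor>x * 2 ^ Suc m\<rfloor> = 2 * k + d"
      using dyadic_step[of x m] unfolding k_def by blast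
    have r1: "r (Suc m) = (of_int (2 * k) + of_int d) / 2 ^ Suc m"
      unfolding r_def eq by simp
    have r0: "r m = of_int (2 * k) / 2 ^ Suc m"
      unfolding r_def k_def by simp
    have "\<bar>apply_bcontfun f ((of_int (2 * k) + 1) / 2 ^ Suc m) - apply_bcontfun f (of_int (2 * k) / 2 ^ Suc m)\<bar>
        \<le> K * a ^ Suc m"
      using f[of "Suc m"] unfolding dyadic_bounded_def by blast
    moreover have "0 \<le> K * a ^ Suc m" using a K by simp
    ultimately show ?thesis using d unfolding r0 r1 by auto
  qed
  have part: "\<bar>apply_bcontfun f (r (n + j)) - apply_bcontfun f (r n)\<bar> \<le> K * a ^ Suc n / (1 - a) * (1 - a ^ j)" for j
  proof (induction j)
    case (Suc j)
    have "\<bar>apply_bcontfun f (r (n + Suc j)) - apply_bcontfun f (r n)\<bar>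
        \<le> K * a ^ Suc n / (1 - a) * (1 - a ^ j) + K * a ^ Suc (n + j)"
      using Suc step[of "n + j"] by simp
    also have "\<dots> = K * a ^ Suc n / (1 - a) * (1 - a ^ Suc j)"
      using a by (simp add: field_simps power_add)
    finally show ?case .
  qed simp
  have "r \<longlonglongrightarrow> x"
  proof (rule LIMSEQ_I)
    fix e :: real assume "0 < e"
    then obtain N where N: "(1/2 :: real) ^ N < e"
      using real_arch_pow_inv[of e "1/2"] by auto
    show "\<exists>no. \<forall>n\<ge>no. norm (r n - x) < e"
    proof (intro exI allI impI)
      fix m assume "N \<le> m"
      have "of_int \<lfloor>x * 2 ^ m\<rfloor> \<le> x * 2 ^ m" "x * 2 ^ m < of_int \<lfloor>x * 2 ^ m\<rfloor> + 1" by linarith+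
      then have "\<bar>of_int \<lfloor>x * 2 ^ m\<rfloor> - x * 2 ^ m\<bar> \<le> 1" by linarith
      then have "\<bar>(of_int \<lfloor>x * 2 ^ m\<rfloor> - x * 2 ^ m) / 2 ^ m\<bar> \<le> 1 / 2 ^ m"
        by (subst abs_divide) (auto intro: divide_right_mono)
      then have "\<bar>r m - x\<bar> \<le> (1/2) ^ m"
        unfolding r_def by (simp add: diff_divide_distrib power_one_over)
      also have "\<dots> \<le> (1/2) ^ N" using \<open>N \<le> m\<close> by (intro power_decreasing) auto
      finally show "norm (r m - x) < e" using N by simp
    qed
  qed
  then have "(\<lambda>j. r (j + n)) \<longlonglongrightarrow> x" by (rule LIMSEQ_ignore_initial_segment)
  then have "(\<lambda>j. r (n + j)) \<longlonglongrightarrow> x" by (simp add: add.commute)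
  from continuous_on_tendsto_compose[OF continuous_on_apply_bcontfun[of UNIV f] this]
  have "(\<lambda>j. apply_bcontfun f (r (n + j))) \<longlonglongrightarrow> apply_bcontfun f x" by simp
  then have lim: "(\<lambda>j. \<bar>apply_bcontfun f (r (n + j)) - apply_bcontfun f (r n)\<bar>)
      \<longlonglongrightarrow> \<bar>apply_bcontfun f x - apply_bcontfun f (r n)\<bar>"
    by (intro tendsto_intros)
  have "\<bar>apply_bcontfun f (r (n + j)) - apply_bcontfun f (r n)\<bar> \<le> K * a ^ Suc n / (1 - a)" for j
  proof (rule order.trans[OF part])
    show "K * a ^ Suc n / (1 - a) * (1 - a ^ j) \<le> K * a ^ Suc n / (1 - a)"
      using a K by (intro mult_right_le_one_le) (auto simp: power_le_one)
  qed
  then show ?thesis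
    unfolding r_def[symmetric] by (intro LIMSEQ_le_const2[OF lim]) blast
qed

lemma dyadic_scale:
  fixes h :: real
  assumes "0 < h" "h \<le> 1"
  obtains n where "(1/2) ^ Suc n < h" "h \<le> (1/2) ^ n"
proof -
  obtain N where N: "(1/2 :: real) ^ N < h"
    using real_arch_pow_inv[of h "1/2"] assms by auto
  define m where "m = (LEAST m. (1/2 :: real) ^ m < h)"
  have m: "(1/2) ^ m < h" unfolding m_def using N by (rule LeastI)
  then have "m \<noteq> 0" using assms by (cases m) auto
  then obtain n where n: "m = Suc n" by (cases m) auto
  have "\<not> (1/2) ^ n < h"
    using not_less_Least[of n "\<lambda>m. (1/2 :: real) ^ m < h"] n unfolding m_def by auto
  then show ?thesis using m n that[of n] by auto
qed

lemma dyadic_imp_hoelder: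
  fixes f :: "real \<Rightarrow>\<^sub>C real"
  assumes \<alpha>: "0 < \<alpha>" and f: "\<And>m. dyadic_bounded (2 powr - \<alpha>) m K f" and K: "0 \<le> K"
  shows "\<exists>L::nat. hoelder_bounded \<alpha> L f"
proof -
  define a where "a = (2::real) powr - \<alpha>"
  have a: "0 < a" "a < 1" unfolding a_def using \<alpha> by (auto simp: powr_less_one)
  define L where "L = 2 * K / (1 - a) + K / a"
  have L: "\<bar>apply_bcontfun f t - apply_bcontfun f s\<bar> \<le> L * \<bar>t - s\<bar> powr \<alpha>"
    if st: "0 \<le> s" "s < t" "t \<le> 1" for s t
  proof -
    obtain n where n: "(1/2) ^ Suc n < t - s" "t - s \<le> (1/2) ^ n"
      using dyadic_scale[of "t - s"] st by auto
    define k where "k = \<lfloor>s * 2 ^ n\<rfloor>"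
    define l where "l = \<lfloor>t * 2 ^ n\<rfloor>"
    have "k \<le> l" unfolding k_def l_def using st by (intro floor_mono) auto
    moreover have "t * 2 ^ n \<le> s * 2 ^ n + 1"
      using n(2) by (simp add: field_simps power_one_over)
    then have "l \<le> k + 1" unfolding k_def l_def by linarith
    \<comment> \<open>At the scale of \<open>t - s\<close> the two roundings agree or are neighbours.\<close>
    ultimately have kl: "l = k \<or> l = k + 1" by linarith
    have "0 \<le> K * a ^ n" using a K by simp
    then have mid: "\<bar>apply_bcontfun f (of_int l / 2 ^ n) - apply_bcontfun f (of_int k / 2 ^ n)\<bar> \<le> K * a ^ n"
      using f[of n] kl unfolding dyadic_bounded_def a_def[symmetric] by auto
    have an: "a ^ Suc n \<le> (t - s) powr \<alpha>"
    proof -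
      have "a = (1/2) powr \<alpha>"
        unfolding a_def powr_minus_divide powr_divide by simp
      then have "a ^ m = ((1/2) ^ m) powr \<alpha>" for m
        by (induction m) (simp_all only: power_Suc power_0 powr_mult powr_one_eq_one)
      then have "a ^ Suc n = ((1/2) ^ Suc n) powr \<alpha>" .
      also have "\<dots> \<le> (t - s) powr \<alpha>"
        using n(1) \<alpha> by (intro powr_mono2) auto
      finally show ?thesis .
    qed
    have tail: "\<bar>apply_bcontfun f x - apply_bcontfun f (of_int \<lfloor>x * 2 ^ n\<rfloor> / 2 ^ n)\<bar> \<le> K * a ^ Suc n / (1 - a)" for x
      using f a K unfolding a_def by (rule dyadic_tail_bound)
    have "\<bar>apply_bcontfun f t - apply_bcontfun f s\<bar> \<le> 2 * (K * a ^ Suc n / (1 - a)) + K * a ^ n"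
      using mid tail[of s] tail[of t] unfolding k_def l_def by linarith
    also have "\<dots> = L * a ^ Suc n"
      unfolding L_def using a by (simp add: field_simps)
    also have "\<dots> \<le> L * (t - s) powr \<alpha>"
      using an a K unfolding L_def by (intro mult_left_mono) auto
    finally show ?thesis using st by simp
  qed
  obtain N :: nat where "L \<le> real N" using real_arch_simple by blast
  then have "hoelder_bounded \<alpha> N f"
    unfolding hoelder_bounded_def using L by (meson order.trans mult_right_mono powr_ge_zero)
  then show ?thesis ..
qed

lemma hoelder_bounded_mono:
  assumes "hoelder_bounded \<beta> K f" "\<alpha> \<le> \<beta>" "0 \<le> K"
  shows "hoelder_bounded \<alpha> K f"
  unfolding hoelder_bounded_def
proof (intro allI impI)
  fix s t :: real assume st: "0 \<le> s" "s < t" "t \<le> 1"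
  then have "\<bar>apply_bcontfun f t - apply_bcontfun f s\<bar> \<le> K * \<bar>t - s\<bar> powr \<beta>"
    using assms(1) unfolding hoelder_bounded_def by blast
  also have "\<dots> \<le> K * \<bar>t - s\<bar> powr \<alpha>"
    using st assms by (intro mult_left_mono powr_mono') auto
  finally show "\<bar>apply_bcontfun f t - apply_bcontfun f s\<bar> \<le> K * \<bar>t - s\<bar> powr \<alpha>" .
qed

lemma hoelder_SUP_iff:
  "(SUP (s, t) \<in> {(s, t). 0 \<le> s \<and> s < t \<and> t \<le> 1}.
      ereal (\<bar>apply_bcontfun f t - apply_bcontfun f s\<bar> / \<bar>t - s\<bar> powr \<alpha>)) < \<infinity>
    \<longleftrightarrow> (\<exists>n::nat. hoelder_bounded \<alpha> n f)" (is "?S < \<infinity> \<longleftrightarrow> _")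
proof -
  have le: "?S \<le> ereal (real n) \<longleftrightarrow> hoelder_bounded \<alpha> n f" for n :: nat
    unfolding hoelder_bounded_def by (auto simp: SUP_le_iff divide_le_eq)
  show ?thesis
  proof
    assume "?S < \<infinity>"
    then obtain n :: nat where "?S \<le> ereal (real n)"
      using less_PInf_Ex_of_nat[of ?S] less_imp_le by auto
    then show "\<exists>n::nat. hoelder_bounded \<alpha> n f" using le by blast
  next
    assume "\<exists>n::nat. hoelder_bounded \<alpha> n f"
    then obtain n :: nat where "?S \<le> ereal (real n)" using le by blast
    then show "?S < \<infinity>" using le_less_trans[of ?S "ereal (real n)" \<infinity>] by simp
  qed
qed

text \<open>
  Bounds on increments are closed conditions on the path, also when they involve uncountably many
  pairs of times. Hence the events defined by such bounds are measurable.
\<close>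

lemma closed_dyadic_bounded: "closed {f. dyadic_bounded a m K f}"
proof -
  have "{f. dyadic_bounded a m K f} = (\<Inter>n\<in>{..m}. \<Inter>k::int. {f. \<bar>apply_bcontfun f ((of_int k + 1) / 2 ^ n)
      - apply_bcontfun f (of_int k / 2 ^ n)\<bar> \<le> K * a ^ n})"
    unfolding dyadic_bounded_def by auto
  also have "closed \<dots>"
    by (intro closed_INT ballI closed_Collect_le continuous_intros continuous_on_eval)
  finally show ?thesis .
qed

lemma closed_hoelder_bounded: "closed {f. hoelder_bounded \<alpha> K f}"
proof -
  have "{f. hoelder_bounded \<alpha> K f} = (\<Inter>(s, t)\<in>{(s, t). 0 \<le> s \<and> s < t \<and> t \<le> 1}.
      {f. \<bar>apply_bcontfun f t - apply_bcontfun f s\<bar> \<le> K * \<bar>t - s\<bar> powr \<alpha>})"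
    unfolding hoelder_bounded_def by auto
  also have "closed \<dots>"
    unfolding case_prod_beta by (intro closed_INT ballI closed_Collect_le continuous_intros continuous_on_eval)
  finally show ?thesis .
qed


section \<open>Rapidly decaying tail functions\<close>

text \<open>
  Decay at infinity faster than every power. The bound is required for all positive \<open>x\<close>, which for
  functions bounded by 1, such as tail probabilities, is no further restriction.
\<close>

definition rapid_decay :: "(real \<Rightarrow> real) \<Rightarrow> bool" where
  "rapid_decay h \<longleftrightarrow> (\<forall>p::nat. \<exists>C\<ge>0. \<forall>x>0. h x \<le> C / x ^ p)"

lemma rapid_decay_add:
  assumes "rapid_decay g" "rapid_decay h"
  shows "rapid_decay (\<lambda>x. g x + h x)"
  unfolding rapid_decay_def
proof
  fix p :: nat
  obtain C D where "C \<ge> 0" "D \<ge> 0" "\<forall>x>0. g x \<le> C / x ^ p" "\<forall>x>0. h x \<le> D / x ^ p"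
    using assms unfolding rapid_decay_def by meson
  then show "\<exists>C\<ge>0. \<forall>x>0. g x + h x \<le> C / x ^ p"
    by (intro exI[of _ "C + D"]) (auto simp: add_divide_distrib intro: add_mono)
qed

lemma rapid_decay_scale:
  assumes "rapid_decay h" "0 < c"
  shows "rapid_decay (\<lambda>x. h (c * x))"
  unfolding rapid_decay_def
proof
  fix p :: nat
  obtain C where C: "C \<ge> 0" "\<forall>x>0. h x \<le> C / x ^ p"
    using assms unfolding rapid_decay_def by meson
  then have "h (c * x) \<le> (C / c ^ p) / x ^ p" if "x > 0" for x
    using C(2)[rule_format, of "c * x"] assms(2) that by (simp add: power_mult_distrib)
  then show "\<exists>C\<ge>0. \<forall>x>0. h (c * x) \<le> C / x ^ p"
    using C(1) assms(2) by (intro exI[of _ "C / c ^ p"]) auto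
qed

lemma rapid_decay_mono: "rapid_decay h \<Longrightarrow> (\<And>x. x > 0 \<Longrightarrow> g x \<le> h x) \<Longrightarrow> rapid_decay g"
  unfolding rapid_decay_def by (meson order.trans)

lemma rapid_decay_exp: assumes "C \<ge> 0" shows "rapid_decay (\<lambda>x. C * exp (- x))"
  unfolding rapid_decay_def
proof
  fix p :: nat
  have "x ^ p \<le> (real p) ^ p * exp x" if "x > 0" for x :: real
  proof (cases "p = 0")
    case False
    have "x / p \<le> exp (x / p)" using exp_ge_add_one_self[of "x/p"] by linarith
    then have "(x / p) ^ p \<le> exp (x / p) ^ p" using that by (intro power_mono) auto
    also have "\<dots> = exp x" using False by (simp add: exp_of_nat_mult[symmetric])
    finally show ?thesis using False by (simp add: power_divide field_simps)
  qed (use that in simp)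
  then have "C * exp (- x) \<le> (C * real p ^ p) / x ^ p" if "x > 0" for x
    using that assms by (simp add: exp_minus field_simps mult_left_mono)
  then show "\<exists>D\<ge>0. \<forall>x>0. C * exp (- x) \<le> D / x ^ p"
    using assms by (intro exI[of _ "C * real p ^ p"]) auto
qed

text \<open>
  The quadratic term decays at twice the rate of \<open>t\<close>. The linear term \<open>2 t (3/2 x)\<close> is removed by
  iteration: a decay rate of at least two turns it into a contraction by \<open>2 / (3/2)\<^sup>2 = 8/9\<close>.
\<close>

lemma quadratic_bootstrap_step:
  fixes t h :: "real \<Rightarrow> real"
  assumes a: "a \<ge> 2" and C: "C \<ge> 0" and t: "\<And>x. x > 0 \<Longrightarrow> t x \<le> C / x ^ a" and t0: "\<And>x. t x \<ge> 0"
    and D: "D \<ge> 0" and h: "\<And>x. x > 0 \<Longrightarrow> h x \<le> D / x ^ (2 * a)"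
    and rec: "\<And>x. x > 0 \<Longrightarrow> t x \<le> h x + (t (x / 4))\<^sup>2 + 2 * t (3 / 2 * x)"
  shows "\<exists>E\<ge>0. \<forall>x>0. t x \<le> E / x ^ (2 * a)"
proof -
  define D' where "D' = D + C\<^sup>2 * 4 ^ (2 * a)"
  have "D' \<ge> 0" unfolding D'_def using D by simp
  have rec': "t x \<le> D' / x ^ (2 * a) + 2 * t (3 / 2 * x)" if x: "x > 0" for x
  proof -
    have "(t (x / 4))\<^sup>2 \<le> (C / (x / 4) ^ a)\<^sup>2"
      using t[of "x/4"] t0 x by (intro power_mono) auto
    also have "\<dots> = C\<^sup>2 * 4 ^ (2 * a) / x ^ (2 * a)"
      using x by (simp add: power_divide power_mult_distrib power_mult[symmetric] mult.commute)
    finally show ?thesis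
      using rec[OF x] h[OF x] unfolding D'_def by (simp add: add_divide_distrib)
  qed
  have pow: "(9 / 4 :: real) \<le> (3 / 2) ^ b" if "b \<ge> 2" for b :: nat
    using power_increasing[of 2 b "3/2 :: real"] that by (simp add: power2_eq_square)
  \<comment> \<open>The constant \<open>9 D'\<close> solves \<open>E = D' + 8/9 E\<close>.\<close>
  have iter: "t x \<le> 9 * D' / x ^ (2 * a) + C / x ^ a * (8 / 9) ^ n" if x: "x > 0" for x and n :: nat
    using x
  proof (induction n arbitrary: x)
    case 0
    have "t x \<le> C / x ^ a" by (rule t) fact
    moreover have "0 \<le> 9 * D' / x ^ (2 * a)" using 0 \<open>D' \<ge> 0\<close> by simp
    ultimately show ?case by simp
  next
    case (Suc n)
    have "t x \<le> D' / x ^ (2 * a) + 2 * t (3 / 2 * x)" by (rule rec') fact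
    also have "t (3 / 2 * x) \<le> 9 * D' / (3 / 2 * x) ^ (2 * a) + C / (3 / 2 * x) ^ a * (8 / 9) ^ n"
      using Suc by simp
    also have "9 * D' / (3 / 2 * x) ^ (2 * a) \<le> 4 * D' / x ^ (2 * a)"
    proof -
      have "9 * D' / (3 / 2 * x) ^ (2 * a) = 9 * D' / x ^ (2 * a) / (3 / 2) ^ (2 * a)"
        unfolding power_mult_distrib by (simp add: mult.commute)
      also have "\<dots> \<le> 9 * D' / x ^ (2 * a) / (9 / 4)"
        using pow[of "2 * a"] a Suc \<open>D' \<ge> 0\<close> by (intro divide_left_mono) auto
      finally show ?thesis by simp
    qed
    also have "C / (3 / 2 * x) ^ a * (8 / 9) ^ n \<le> 4 / 9 * (C / x ^ a * (8 / 9) ^ n)"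
    proof -
      have "C / (3 / 2 * x) ^ a * (8 / 9) ^ n = C / x ^ a * (8 / 9) ^ n / (3 / 2) ^ a"
        unfolding power_mult_distrib by (simp add: mult.commute)
      also have "\<dots> \<le> C / x ^ a * (8 / 9) ^ n / (9 / 4)"
        using pow[of a] a Suc C by (intro divide_left_mono) auto
      finally show ?thesis by simp
    qed
    finally show ?case by simp
  qed
  have "t x \<le> 9 * D' / x ^ (2 * a)" if x: "x > 0" for x
  proof (rule LIMSEQ_le_const)
    have "(\<lambda>n. 9 * D' / x ^ (2 * a) + C / x ^ a * (8 / 9) ^ n) \<longlonglongrightarrow> 9 * D' / x ^ (2 * a) + C / x ^ a * 0"
      by (intro tendsto_intros LIMSEQ_power_zero) auto
    then show "(\<lambda>n. 9 * D' / x ^ (2 * a) + C / x ^ a * (8 / 9) ^ n) \<longlonglongrightarrow> 9 * D' / x ^ (2 * a)" by simp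
  qed (use iter[OF x] in blast)
  then show ?thesis using \<open>D' \<ge> 0\<close> by (intro exI[of _ "9 * D'"]) auto
qed

lemma quadratic_bootstrap:
  fixes t h :: "real \<Rightarrow> real"
  assumes "C \<ge> 0" and t: "\<And>x. x > 0 \<Longrightarrow> t x \<le> C / x\<^sup>2" and t0: "\<And>x. t x \<ge> 0" and t1: "\<And>x. t x \<le> 1"
    and h: "rapid_decay h"
    and rec: "\<And>x. x > 0 \<Longrightarrow> t x \<le> h x + (t (x / 4))\<^sup>2 + 2 * t (3 / 2 * x)"
  shows "rapid_decay t"
proof -
  have pow: "\<exists>C\<ge>0. \<forall>x>0. t x \<le> C / x ^ (2 ^ Suc j)" for j
  proof (induction j)
    case 0
    then show ?case using assms(1) t by auto
  next
    case (Suc j)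
    then obtain C where C: "C \<ge> 0" "\<forall>x>0. t x \<le> C / x ^ (2 ^ Suc j)" by blast
    obtain D where D: "D \<ge> 0" "\<forall>x>0. h x \<le> D / x ^ (2 * 2 ^ Suc j)"
      using h unfolding rapid_decay_def by blast
    have "2 \<le> (2::nat) ^ Suc j" by simp
    from quadratic_bootstrap_step[OF this C(1) _ t0 D(1) _ rec] C(2) D(2)
    show ?case by simp
  qed
  show ?thesis
    unfolding rapid_decay_def
  proof
    fix p :: nat
    have p: "p \<le> 2 ^ Suc p" using less_exp[of p] by (simp add: less_imp_le trans_le_add1 mult_2)
    obtain C where C: "C \<ge> 0" "\<forall>x>0. t x \<le> C / x ^ (2 ^ Suc p)" using pow by blast
    have "t x \<le> max C 1 / x ^ p" if x: "x > 0" for x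
    proof (cases "x \<le> 1")
      case True
      have "t x * x ^ p \<le> 1 * 1" using t0 t1 True x by (intro mult_mono) (auto simp: power_le_one)
      then show ?thesis using x by (simp add: le_divide_eq)
    next
      case False
      have "t x \<le> C / x ^ (2 ^ Suc p)" using C x by blast
      also have "\<dots> \<le> C / x ^ p"
        using False C(1) p by (intro divide_left_mono power_increasing) auto
      also have "\<dots> \<le> max C 1 / x ^ p" using x by (intro divide_right_mono) auto
      finally show ?thesis .
    qed
    then show "\<exists>C\<ge>0. \<forall>x>0. t x \<le> C / x ^ p" by (intro exI[of _ "max C 1"]) auto
  qed
qed

section \<open>The uniform distribution on the unit interval\<close>

lemma prob_space_unif: "prob_space unif"
  by (intro prob_space_uniform_measure) auto

lemma sets_unif [measurable_cong, simp]: "sets unif = sets borel"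
  by simp

lemma space_unif [simp]: "space unif = UNIV"
  by simp

lemma measure_unif: "A \<in> sets borel \<Longrightarrow> measure unif A = measure lborel ({0<..<1} \<inter> A)"
  by (subst measure_uniform_measure) auto

lemma measure_unif_less: "0 < r \<Longrightarrow> measure unif {..<r} \<le> r"
proof -
  assume r: "0 < r"
  have "measure unif {..<r} = measure lborel ({0<..<1} \<inter> {..<r})" by (rule measure_unif) simp
  also have "{0<..<1} \<inter> {..<r} = {0<..<min 1 r}" by auto
  also have "measure lborel {0<..<min 1 r} = min 1 r" using r by simp
  finally show ?thesis by simp
qed

lemma measure_unif_greater: "0 < r \<Longrightarrow> measure unif {1 - r<..} \<le> r"
proof -
  assume r: "0 < r"
  have "measure unif {1 - r<..} = measure lborel ({0<..<1} \<inter> {1 - r<..})" by (rule measure_unif) simp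
  also have "{0<..<1} \<inter> {1 - r<..} = {max 0 (1 - r)<..<1}" by auto
  also have "measure lborel {max 0 (1 - r)<..<1} = 1 - max 0 (1 - r)" using r by (subst measure_lborel_Ioo) auto
  finally show ?thesis by simp
qed

lemma AE_unif: "AE \<xi> in unif. 0 < \<xi> \<and> \<xi> < 1"
  by (rule AE_uniform_measureI) auto

lemma unif_log_tail: "measure unif {\<xi>. y < \<bar>ln \<xi>\<bar> + \<bar>ln (1 - \<xi>)\<bar>} \<le> 2 * exp (- y / 2)"
proof -
  interpret U: prob_space unif by (rule prob_space_unif)
  let ?r = "exp (- y / 2)"
  have "measure unif {\<xi>. y < \<bar>ln \<xi>\<bar> + \<bar>ln (1 - \<xi>)\<bar>} \<le> measure unif ({..<?r} \<union> {1 - ?r<..})"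
  proof (rule U.finite_measure_mono_AE)
    show "AE \<xi> in unif. \<xi> \<in> {\<xi>. y < \<bar>ln \<xi>\<bar> + \<bar>ln (1 - \<xi>)\<bar>} \<longrightarrow> \<xi> \<in> {..<?r} \<union> {1 - ?r<..}"
      using AE_unif
    proof eventually_elim
      case (elim \<xi>)
      have "\<xi> < ?r" if "y / 2 < \<bar>ln \<xi>\<bar>"
      proof -
        have "ln \<xi> < - y / 2" using that elim by (simp add: abs_if split: if_splits)
        then show ?thesis using elim by (metis exp_less_cancel_iff exp_ln)
      qed
      moreover have "1 - \<xi> < ?r" if "y / 2 < \<bar>ln (1 - \<xi>)\<bar>"
      proof -
        have "ln (1 - \<xi>) < - y / 2" using that elim by (simp add: abs_if split: if_splits)
        then show ?thesis using elim by (metis exp_less_cancel_iff exp_ln diff_gt_0_iff_gt)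
      qed
      ultimately show ?case by (cases "y / 2 < \<bar>ln \<xi>\<bar>") auto
    qed
  qed simp
  also have "\<dots> \<le> measure unif {..<?r} + measure unif {1 - ?r<..}"
    by (rule measure_Un_le) auto
  also have "\<dots> \<le> ?r + ?r"
    by (intro add_mono measure_unif_less measure_unif_greater) auto
  finally show ?thesis by simp
qed


section \<open>The fixed point equation in terms of independent variables\<close>

text \<open>
  A law \<open>\<mu>\<close> in \<open>M_set\<close> that is a fixed point of \<open>Psi\<close>.
\<close>

locale recursion_fixed_point =
  fixes \<mu> :: "point measure"
  assumes in_M_set: "\<mu> \<in> M_set" and Psi_fixed: "Psi \<mu> = \<mu>"
begin

text \<open>
  The joint law of the ingredients of one step.
\<close>

definition Q :: "innovation measure" where
  "Q = \<mu> \<Otimes>\<^sub>M \<mu> \<Otimes>\<^sub>M unif"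

lemma sets_\<mu> [measurable_cong]: "sets \<mu> = sets S_borel"
  using in_M_set by (simp add: M_set_def)

lemma space_\<mu>: "space \<mu> = C00 \<times> UNIV"
  using sets_eq_imp_space_eq[OF sets_\<mu>] by (simp add: space_S_borel)

sublocale prob_space \<mu>
  using in_M_set by (simp add: M_set_def)

sublocale U: prob_space unif by (rule prob_space_unif)

sublocale N: pair_prob_space \<mu> unif ..

sublocale QQ: pair_prob_space \<mu> "\<mu> \<Otimes>\<^sub>M unif" ..

sublocale Q: prob_space Q unfolding Q_def by (rule QQ.prob_space_axioms)

lemma measurable_eval_\<mu> [measurable]: "(\<lambda>z. apply_bcontfun (fst z) t) \<in> borel_measurable \<mu>"
  using measurable_eval measurable_cong_sets[OF sets_\<mu> refl] by blast

lemma measurable_snd_\<mu> [measurable]: "snd \<in> borel_measurable \<mu>"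
  using measurable_snd_S_borel measurable_cong_sets[OF sets_\<mu> refl] by blast

lemma sets_Q [measurable_cong]: "sets Q = sets (\<mu> \<Otimes>\<^sub>M \<mu> \<Otimes>\<^sub>M borel)"
  unfolding Q_def by (intro sets_pair_measure_cong) auto

lemma space_Q: "space Q = space \<mu> \<times> space \<mu> \<times> UNIV"
  by (simp add: Q_def space_pair_measure)

lemma recur_measurable [measurable]: "recur \<in> measurable Q \<mu>"
  using measurable_recur[OF sets_\<mu>] measurable_cong_sets[OF refl sets_\<mu>] unfolding Q_def by blast

lemma distr_recur: "distr Q \<mu> recur = \<mu>"
proof -
  have "distr Q \<mu> recur = distr Q S_borel recur"
    by (rule distr_cong) (auto simp: sets_\<mu>)
  also have "\<dots> = Psi \<mu>" by (simp add: Psi_eq_distr_recur Q_def)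
  finally show ?thesis by (simp add: Psi_fixed)
qed

text \<open>
  The fixed point equation: the result of one step has law \<open>\<mu>\<close>.
\<close>

lemma prob_recur:
  assumes "A \<in> sets \<mu>"
  shows "prob A = Q.prob {q \<in> space Q. recur q \<in> A}"
proof -
  have "prob A = measure (distr Q \<mu> recur) A" by (simp add: distr_recur)
  also have "\<dots> = Q.prob {q \<in> space Q. recur q \<in> A}"
    using assms by (subst measure_distr) (auto intro!: arg_cong[where f="Q.prob"])
  finally show ?thesis .
qed

lemma prob_rectangle:
  assumes "A \<in> sets \<mu>" "B \<in> sets \<mu>" "C \<in> sets borel"
  shows "Q.prob (A \<times> B \<times> C) = prob A * prob B * measure unif C"
  unfolding Q_def using assms
  by (simp add: measure_def N.emeasure_pair_measure_Times U.emeasure_pair_measure_Times enn2real_mult mult.assoc)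

lemma prob_first: "A \<in> sets \<mu> \<Longrightarrow> Q.prob {q \<in> space Q. fst q \<in> A} = prob A"
proof -
  assume A: "A \<in> sets \<mu>"
  have "{q \<in> space Q. fst q \<in> A} = A \<times> space \<mu> \<times> UNIV"
    using sets.sets_into_space[OF A] by (auto simp: space_Q)
  then show ?thesis
    using prob_rectangle[OF A sets.top, of UNIV] prob_space U.prob_space by simp
qed

lemma prob_second: "A \<in> sets \<mu> \<Longrightarrow> Q.prob {q \<in> space Q. fst (snd q) \<in> A} = prob A"
proof -
  assume A: "A \<in> sets \<mu>"
  have "{q \<in> space Q. fst (snd q) \<in> A} = space \<mu> \<times> A \<times> UNIV"
    using sets.sets_into_space[OF A] by (auto simp: space_Q)
  then show ?thesis
    using prob_rectangle[OF sets.top A, of UNIV] prob_space U.prob_space by simp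
qed

lemma prob_both: "A \<in> sets \<mu> \<Longrightarrow> B \<in> sets \<mu> \<Longrightarrow>
  Q.prob {q \<in> space Q. fst q \<in> A \<and> fst (snd q) \<in> B} = prob A * prob B"
proof -
  assume A: "A \<in> sets \<mu>" and B: "B \<in> sets \<mu>"
  have "{q \<in> space Q. fst q \<in> A \<and> fst (snd q) \<in> B} = A \<times> B \<times> UNIV"
    using sets.sets_into_space[OF A] sets.sets_into_space[OF B] by (auto simp: space_Q)
  then show ?thesis
    using prob_rectangle[OF A B, of UNIV] U.prob_space by simp
qed

lemma prob_third: "A \<in> sets borel \<Longrightarrow> Q.prob {q \<in> space Q. snd (snd q) \<in> A} = measure unif A"
proof -
  assume A: "A \<in> sets borel"
  have "{q \<in> space Q. snd (snd q) \<in> A} = space \<mu> \<times> space \<mu> \<times> A"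
    by (auto simp: space_Q)
  then show ?thesis
    using prob_rectangle[OF sets.top sets.top A] prob_space by simp
qed

section \<open>Tails of the real component\<close>

definition tail :: "real \<Rightarrow> real" where
  "tail x = prob {z \<in> space \<mu>. x < \<bar>snd z\<bar>}"

lemma integrable_snd_sq: "integrable \<mu> (\<lambda>z. (snd z)\<^sup>2)"
proof (rule integrableI_bounded)
  have "(\<integral>\<^sup>+ z. ennreal (norm ((snd z)\<^sup>2)) \<partial>\<mu>) \<le> (\<integral>\<^sup>+ (f, x). ennreal ((norm f)\<^sup>2 + x\<^sup>2) \<partial>\<mu>)"
    by (intro nn_integral_mono) (auto intro!: ennreal_leI)
  also have "\<dots> < \<infinity>" using in_M_set by (simp add: M_set_def)
  finally show "(\<integral>\<^sup>+ z. ennreal (norm ((snd z)\<^sup>2)) \<partial>\<mu>) < \<infinity>" .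
qed measurable

lemma integrable_snd: "integrable \<mu> snd"
  by (rule square_integrable_imp_integrable) (auto simp: integrable_snd_sq)

lemma expectation_snd: "expectation snd = 0"
  using in_M_set by (simp add: M_set_def case_prod_beta')

lemma tail_chebyshev:
  assumes "0 < x"
  shows "tail x \<le> expectation (\<lambda>z. (snd z)\<^sup>2) / x\<^sup>2"
proof -
  have "tail x \<le> prob {z \<in> space \<mu>. x\<^sup>2 \<le> (snd z)\<^sup>2}"
    unfolding tail_def using assms
    by (intro finite_measure_mono) (auto simp: abs_le_square_iff[symmetric])
  also have "\<dots> \<le> expectation (\<lambda>z. (snd z)\<^sup>2) / x\<^sup>2"
    using assms by (intro integral_Markov_inequality_measure[where A="{}"]) (auto simp: integrable_snd_sq)
  finally show ?thesis .
qed

text \<open>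
  If, in absolute value, neither copy exceeds \<open>3/2 x\<close> and one of them is at most \<open>x/4\<close>, then their mean
  is at most \<open>7/8 x\<close>, which leaves more than \<open>x/8\<close> for the toll. The exponential term bounds the tail
  of the toll.
\<close>

lemma tail_rec:
  assumes x: "0 < x"
  shows "tail x \<le> 2 * exp 1 * exp (- (1/8 * x)) + (tail (x / 4))\<^sup>2 + 2 * tail (3 / 2 * x)"
proof -
  let ?E = "\<lambda>y. {z \<in> space \<mu>. y < \<bar>snd z\<bar>}"
  have E: "?E y \<in> sets \<mu>" for y by measurable
  have T: "{\<xi>. x / 4 - 2 < \<bar>ln \<xi>\<bar> + \<bar>ln (1 - \<xi>)\<bar>} \<in> sets borel" by measurable
  let ?G = "{q \<in> space Q. snd (snd q) \<in> {\<xi>. x / 4 - 2 < \<bar>ln \<xi>\<bar> + \<bar>ln (1 - \<xi>)\<bar>}}"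
  let ?H = "{q \<in> space Q. fst q \<in> ?E (x / 4) \<and> fst (snd q) \<in> ?E (x / 4)}"
  let ?I = "{q \<in> space Q. fst q \<in> ?E (3 / 2 * x)}"
  let ?J = "{q \<in> space Q. fst (snd q) \<in> ?E (3 / 2 * x)}"
  have meas: "?G \<in> sets Q" "?H \<in> sets Q" "?I \<in> sets Q" "?J \<in> sets Q"
    by measurable
  have "tail x = Q.prob {q \<in> space Q. recur q \<in> ?E x}"
    unfolding tail_def by (rule prob_recur[OF E])
  also have "\<dots> \<le> Q.prob (?G \<union> ?H \<union> ?I \<union> ?J)"
  proof (rule Q.finite_measure_mono)
    show "{q \<in> space Q. recur q \<in> ?E x} \<subseteq> ?G \<union> ?H \<union> ?I \<union> ?J"
    proof (rule subsetI, rule ccontr)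
      fix q assume q: "q \<in> {q \<in> space Q. recur q \<in> ?E x}" and nq: "q \<notin> ?G \<union> ?H \<union> ?I \<union> ?J"
      define \<eta> \<eta>' \<xi> where "\<eta> = snd (fst q)" and "\<eta>' = snd (fst (snd q))" and "\<xi> = snd (snd q)"
      note defs = this
      have *: "x < \<bar>(\<eta> + \<eta>') / 2 + toll \<xi>\<bar>" using q by (simp add: recur_def defs)
      have le: "\<bar>\<eta>\<bar> \<le> 3 / 2 * x" "\<bar>\<eta>'\<bar> \<le> 3 / 2 * x" "\<bar>\<eta>\<bar> \<le> x / 4 \<or> \<bar>\<eta>'\<bar> \<le> x / 4"
        using nq q by (auto simp: not_less defs space_Q)
      have "\<bar>(\<eta> + \<eta>') / 2 + toll \<xi>\<bar> \<le> \<bar>(\<eta> + \<eta>') / 2\<bar> + \<bar>toll \<xi>\<bar>"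
        by (rule abs_triangle_ineq)
      also have "\<bar>(\<eta> + \<eta>') / 2\<bar> \<le> (\<bar>\<eta>\<bar> + \<bar>\<eta>'\<bar>) / 2"
        using divide_right_mono[OF abs_triangle_ineq[of \<eta> \<eta>'], of 2] unfolding abs_divide by simp
      finally have "\<bar>(\<eta> + \<eta>') / 2 + toll \<xi>\<bar> \<le> (\<bar>\<eta>\<bar> + \<bar>\<eta>'\<bar>) / 2 + \<bar>toll \<xi>\<bar>"
        by simp
      moreover have "x / 8 < c" if "x < u" "u \<le> (v + v') / 2 + c" "v \<le> 3 / 2 * x" "v' \<le> 3 / 2 * x" "v \<le> x / 4 \<or> v' \<le> x / 4"
        for u v v' c :: real using that unfolding add_divide_distrib by (elim disjE) linarith+
      ultimately have "x / 8 < \<bar>toll \<xi>\<bar>" using * le by blast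
      also have "\<bar>toll \<xi>\<bar> \<le> 1 + 1/2 * \<bar>ln \<xi>\<bar> + 1/2 * \<bar>ln (1 - \<xi>)\<bar>"
        unfolding toll_def distrib_left by linarith
      finally have "x / 4 - 2 < \<bar>ln \<xi>\<bar> + \<bar>ln (1 - \<xi>)\<bar>" by simp
      then show False using nq q by (auto simp: defs)
    qed
  qed (use meas in measurable)
  also have "\<dots> \<le> Q.prob ?G + Q.prob ?H + Q.prob ?I + Q.prob ?J"
    using meas by (intro order.trans[OF measure_Un_le] add_right_mono order.refl sets.Un)
  also have "Q.prob ?G = measure unif {\<xi>. x / 4 - 2 < \<bar>ln \<xi>\<bar> + \<bar>ln (1 - \<xi>)\<bar>}"
    by (rule prob_third[OF T])
  also have "\<dots> \<le> 2 * exp (- (x / 4 - 2) / 2)" by (rule unif_log_tail)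
  also have "exp (- (x / 4 - 2) / 2) = exp 1 * exp (- (1/8 * x))"
    by (simp add: exp_add[symmetric] field_simps)
  also have "Q.prob ?H = tail (x / 4) * tail (x / 4)"
    unfolding tail_def by (rule prob_both[OF E E])
  also have "Q.prob ?I = tail (3 / 2 * x)" unfolding tail_def by (rule prob_first[OF E])
  also have "Q.prob ?J = tail (3 / 2 * x)" unfolding tail_def by (rule prob_second[OF E])
  finally show ?thesis by (simp add: power2_eq_square)
qed

lemma rapid_decay_tail: "rapid_decay tail"
proof (rule quadratic_bootstrap[where C="expectation (\<lambda>z. (snd z)\<^sup>2)"])
  show "rapid_decay (\<lambda>x. 2 * exp 1 * exp (- (1/8 * x)))"
    using rapid_decay_scale[OF rapid_decay_exp[of "2 * exp 1"], of "1/8"] by simp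
qed (use tail_chebyshev tail_rec in \<open>auto simp: tail_def\<close>)

definition drift_tail :: "real \<Rightarrow> real" where
  "drift_tail x = Q.prob {q \<in> space Q. x < \<bar>drift q\<bar>}"

lemma drift_measurable [measurable]: "drift \<in> borel_measurable Q"
  unfolding drift_def by measurable

lemma rapid_decay_drift_tail: "rapid_decay drift_tail"
proof (rule rapid_decay_mono)
  show "rapid_decay (\<lambda>x. tail (1/4 * x) + tail (1/4 * x) + 2 * exp (- (1/4 * x)))"
    using rapid_decay_scale[OF rapid_decay_exp[of 2], of "1/4"]
    by (intro rapid_decay_add rapid_decay_scale[OF rapid_decay_tail]) auto
next
  fix x :: real assume "x > 0"
  let ?E = "{z \<in> space \<mu>. 1/4 * x < \<bar>snd z\<bar>}"
  have E: "?E \<in> sets \<mu>" by measurable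
  have T: "{\<xi>. x / 2 < \<bar>ln \<xi>\<bar> + \<bar>ln (1 - \<xi>)\<bar>} \<in> sets borel" by measurable
  let ?G = "{q \<in> space Q. snd (snd q) \<in> {\<xi>. x / 2 < \<bar>ln \<xi>\<bar> + \<bar>ln (1 - \<xi>)\<bar>}}"
  let ?I = "{q \<in> space Q. fst q \<in> ?E}"
  let ?J = "{q \<in> space Q. fst (snd q) \<in> ?E}"
  have meas: "?I \<in> sets Q" "?J \<in> sets Q" "?G \<in> sets Q" by measurable
  have "drift_tail x \<le> Q.prob (?I \<union> ?J \<union> ?G)"
    unfolding drift_tail_def
  proof (rule Q.finite_measure_mono)
    show "{q \<in> space Q. x < \<bar>drift q\<bar>} \<subseteq> ?I \<union> ?J \<union> ?G"
      by (auto simp: space_Q drift_def)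
  qed (use meas in measurable)
  also have "\<dots> \<le> Q.prob ?I + Q.prob ?J + Q.prob ?G"
    using meas by (intro order.trans[OF measure_Un_le] add_right_mono order.refl sets.Un)
  also have "Q.prob ?I = tail (1/4 * x)" unfolding tail_def by (rule prob_first[OF E])
  also have "Q.prob ?J = tail (1/4 * x)" unfolding tail_def by (rule prob_second[OF E])
  also have "Q.prob ?G = measure unif {\<xi>. x / 2 < \<bar>ln \<xi>\<bar> + \<bar>ln (1 - \<xi>)\<bar>}" by (rule prob_third[OF T])
  also have "\<dots> \<le> 2 * exp (- (x / 2) / 2)" by (rule unif_log_tail)
  finally show "drift_tail x \<le> tail (1/4 * x) + tail (1/4 * x) + 2 * exp (- (1/4 * x))" by simp
qed

section \<open>Hoelder continuity below exponent one\<close>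

lemma closed_evals:
  fixes \<phi> :: "(real \<Rightarrow>\<^sub>C real) \<Rightarrow> bool"
  assumes "closed {f. \<phi> f}"
  shows "{z \<in> space \<mu>. \<phi> (fst z)} \<in> sets \<mu>"
proof -
  have "closed (fst -` {f. \<phi> f} :: point set)"
    using assms by (intro closed_vimage continuous_on_fst continuous_on_id)
  then have "fst -` {f. \<phi> f} \<inter> (C00 \<times> UNIV) \<in> sets S_borel"
    unfolding S_borel_def sets_restrict_space by (auto simp: image_iff Int_commute)
  also have "fst -` {f. \<phi> f} \<inter> (C00 \<times> UNIV) = {z \<in> space \<mu>. \<phi> (fst z)}"
    by (auto simp: space_\<mu>)
  finally show ?thesis by (simp add: sets_\<mu>)
qed

lemma dyadic_sets [measurable]: "{z \<in> space \<mu>. dyadic_bounded a m K (fst z)} \<in> sets \<mu>"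
  by (rule closed_evals) (rule closed_dyadic_bounded)

lemma hoelder_sets [measurable]: "{z \<in> space \<mu>. hoelder_bounded \<alpha> K (fst z)} \<in> sets \<mu>"
  by (rule closed_evals) (rule closed_hoelder_bounded)

text \<open>
  An increment of level \<open>n + 1\<close> of the glued path is half an increment of level \<open>n\<close> of one of the two
  copies, up to an increment of the tent. Halving outweighs the factor \<open>1/a\<close> since \<open>a > 1/2\<close>.
\<close>

lemma dyadic_bounded_glue:
  assumes C00: "fst (fst q) \<in> C00" "fst (fst (snd q)) \<in> C00"
    and "dyadic_bounded a m K' (fst (fst q))" "dyadic_bounded a m K' (fst (fst (snd q)))"
    and a: "1/2 < a" and K: "K' / (2 * a) + \<bar>drift q\<bar> \<le> K"
  shows "dyadic_bounded a (Suc m) K (glue q)"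
  unfolding dyadic_bounded_def
proof (intro allI impI)
  fix n :: nat and k :: int assume n: "n \<le> Suc m"
  let ?y = "apply_bcontfun (fst (fst q))" and ?y' = "apply_bcontfun (fst (fst (snd q)))"
  let ?D = "\<bar>apply_bcontfun (glue q) ((of_int k + 1) / 2 ^ n) - apply_bcontfun (glue q) (of_int k / 2 ^ n)\<bar>"
  have "\<bar>?y ((0 + 1) / 2 ^ 0) - ?y (0 / 2 ^ 0)\<bar> \<le> K' * a ^ 0"
    using assms(3) unfolding dyadic_bounded_def by (metis le0 of_int_0)
  then have "0 \<le> K'" by simp
  then have "0 \<le> K" using K a by (smt (verit) divide_nonneg_nonneg)
  show "?D \<le> K * a ^ n"
  proof (cases n)
    case 0
    have "glue q \<in> C00" unfolding glue_def
      using C00 by (intro C00_add C00_scaleR opA_C00 opB_C00 phi_C00)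
    from C00_of_int[OF this, of k] C00_of_int[OF this, of "k + 1"] show ?thesis using \<open>0 \<le> K\<close> 0 by simp
  next
    case (Suc l)
    then have l: "l \<le> m" using n by simp
    have halves: "?D \<le> K' * a ^ l / 2 + \<bar>drift q\<bar> * (1/2) ^ n"
    proof -
      have phi: "\<bar>drift q * apply_bcontfun phi ((of_int k + 1) / 2 ^ n) - drift q * apply_bcontfun phi (of_int k / 2 ^ n)\<bar>
          \<le> \<bar>drift q\<bar> * (1/2) ^ n"
      proof -
        have "\<bar>apply_bcontfun phi ((of_int k + 1) / 2 ^ n) - apply_bcontfun phi (of_int k / 2 ^ n)\<bar>
            \<le> \<bar>(of_int k + 1) / 2 ^ n - of_int k / 2 ^ n\<bar> / 2" by (rule phi_lipschitz)
        also have "\<dots> \<le> (1/2) ^ n" by (simp add: diff_divide_distrib[symmetric] power_one_over field_simps)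
        finally show ?thesis
          unfolding right_diff_distrib[symmetric] abs_mult by (rule mult_left_mono) simp
      qed
      show ?thesis
      proof (cases "k + 1 \<le> 2 ^ l")
        case True
        then have "real_of_int (k + 1) \<le> real_of_int (2 ^ l)" by (simp only: of_int_le_iff)
        then have kl: "of_int k + 1 \<le> (2::real) ^ l" by simp
        then have kl': "of_int k \<le> (2::real) ^ l" by linarith
        have half: "(2::real) ^ l / 2 ^ n = 1/2" using Suc by simp
        have le: "(of_int k + 1) / 2 ^ n \<le> (1/2::real)" "of_int k / 2 ^ n \<le> (1/2::real)"
          unfolding half[symmetric] by (intro divide_right_mono kl kl', simp)+
        have "\<bar>?y ((of_int k + 1) / 2 ^ l) - ?y (of_int k / 2 ^ l)\<bar> \<le> K' * a ^ l"
          using assms(3) l unfolding dyadic_bounded_def by blast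
        moreover have "2 * ((of_int k + 1) / 2 ^ n) = (of_int k + 1) / (2::real) ^ l"
          "2 * (of_int k / 2 ^ n) = of_int k / (2::real) ^ l" unfolding Suc by (simp_all add: field_simps)
        ultimately show ?thesis
          using phi unfolding glue_left[OF C00 le(1)] glue_left[OF C00 le(2)] by (simp only:)
      next
        case False
        then have "2 ^ l \<le> k" by simp
        then have "real_of_int (2 ^ l) \<le> real_of_int k" by (simp only: of_int_le_iff)
        then have kl: "(2::real) ^ l \<le> of_int k" by simp
        then have kl': "(2::real) ^ l \<le> of_int k + 1" by linarith
        have half: "(2::real) ^ l / 2 ^ n = 1/2" using Suc by simp
        have le: "(1/2::real) \<le> (of_int k + 1) / 2 ^ n" "(1/2::real) \<le> of_int k / 2 ^ n"
          unfolding half[symmetric] by (intro divide_right_mono kl kl', simp)+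
        have "\<bar>?y' ((of_int (k - 2 ^ l) + 1) / 2 ^ l) - ?y' (of_int (k - 2 ^ l) / 2 ^ l)\<bar> \<le> K' * a ^ l"
          using assms(4) l unfolding dyadic_bounded_def by blast
        moreover have "2 * ((of_int k + 1) / 2 ^ n) - 1 = (of_int (k - 2 ^ l) + 1) / (2::real) ^ l"
          "2 * (of_int k / 2 ^ n) - 1 = of_int (k - 2 ^ l) / (2::real) ^ l" unfolding Suc by (simp_all add: field_simps)
        ultimately show ?thesis
          using phi unfolding glue_right[OF C00 le(1)] glue_right[OF C00 le(2)] by (simp only:)
      qed
    qed
    also have "\<dots> \<le> K' * a ^ l / 2 + \<bar>drift q\<bar> * a ^ n"
      using a by (intro add_left_mono mult_left_mono power_mono) auto
    also have "\<dots> = (K' / (2 * a) + \<bar>drift q\<bar>) * a ^ n"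
      using a Suc by (simp add: field_simps)
    also have "\<dots> \<le> K * a ^ n" using K a by (intro mult_right_mono) auto
    finally show ?thesis .
  qed
qed

text \<open>
  The bound holds uniformly in the level \<open>m\<close>. At level 0 a failure is impossible because paths vanish
  at the integers; this makes the induction on \<open>m\<close> work without prior knowledge of the path modulus.
\<close>

lemma dyadic_failure_bound:
  assumes a: "1/2 < a"
  obtains C p where "C \<ge> 0" "p \<noteq> 0"
    "\<And>m K. K > 0 \<Longrightarrow> prob {z \<in> space \<mu>. \<not> dyadic_bounded a m K (fst z)} \<le> C / K ^ p"
proof -
  \<comment> \<open>These satisfy \<open>\<rho> > 1\<close>, \<open>c > 0\<close> and \<open>\<rho> / (2 a) + c = 1\<close>: copies bounded by \<open>\<rho> K\<close> and a drift of at most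
      \<open>c K\<close> give a glued path bounded by \<open>K\<close>.\<close>
  define \<rho> where "\<rho> = (1 + 2 * a) / 2"
  define c where "c = 1 - \<rho> / (2 * a)"
  have \<rho>: "1 < \<rho>" and c: "0 < c" unfolding \<rho>_def c_def using a by (simp_all add: field_simps)
  \<comment> \<open>The threshold 4 makes up for the two copies and still leaves a factor \<open>1/2\<close>.\<close>
  obtain p :: nat where p: "4 < \<rho> ^ p" using real_arch_pow[OF \<rho>] by blast
  then have p0: "p \<noteq> 0" by (cases p) auto
  have "rapid_decay (\<lambda>x. drift_tail (c * x))"
    by (rule rapid_decay_scale[OF rapid_decay_drift_tail c])
  then obtain C where C: "C \<ge> 0" "\<And>x. x > 0 \<Longrightarrow> drift_tail (c * x) \<le> C / x ^ p"
    unfolding rapid_decay_def by blast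
  define fail where "fail m K = {z \<in> space \<mu>. \<not> dyadic_bounded a m K (fst z)}" for m K
  have fail_sets: "fail m K \<in> sets \<mu>" for m K unfolding fail_def by measurable
  have "prob (fail m K) \<le> 2 * C / K ^ p" if "K > 0" for m K
    using that
  proof (induction m arbitrary: K)
    case 0
    have "fail 0 K = {}"
      using 0 C00_of_int[of _ "_ + 1"] C00_of_int
      by (auto simp: fail_def dyadic_bounded_def space_\<mu>)
    then show ?case using C(1) 0 by simp
  next
    case (Suc m)
    let ?I = "{q \<in> space Q. fst q \<in> fail m (\<rho> * K)}"
    let ?J = "{q \<in> space Q. fst (snd q) \<in> fail m (\<rho> * K)}"
    let ?G = "{q \<in> space Q. c * K < \<bar>drift q\<bar>}"
    have [measurable]: "fail m (\<rho> * K) \<in> sets \<mu>" by (rule fail_sets)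
    have meas: "?I \<in> sets Q" "?J \<in> sets Q" "?G \<in> sets Q" by measurable
    have "prob (fail (Suc m) K) = Q.prob {q \<in> space Q. recur q \<in> fail (Suc m) K}"
      by (rule prob_recur[OF fail_sets])
    also have "\<dots> \<le> Q.prob (?I \<union> ?J \<union> ?G)"
    proof (rule Q.finite_measure_mono)
      show "{q \<in> space Q. recur q \<in> fail (Suc m) K} \<subseteq> ?I \<union> ?J \<union> ?G"
      proof (intro subsetI, rule ccontr)
        fix q assume q: "q \<in> {q \<in> space Q. recur q \<in> fail (Suc m) K}" and nq: "q \<notin> ?I \<union> ?J \<union> ?G"
        from q have sp: "fst q \<in> space \<mu>" "fst (snd q) \<in> space \<mu>" by (auto simp: space_Q)
        have d: "\<bar>drift q\<bar> \<le> c * K" using nq q by auto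
        have "dyadic_bounded a (Suc m) K (glue q)"
        proof (rule dyadic_bounded_glue)
          show "dyadic_bounded a m (\<rho> * K) (fst (fst q))" "dyadic_bounded a m (\<rho> * K) (fst (fst (snd q)))"
            using nq q sp unfolding fail_def by auto
          show "\<rho> * K / (2 * a) + \<bar>drift q\<bar> \<le> K"
            using d unfolding c_def by (simp add: field_simps)
        qed (use sp a in \<open>auto simp: space_\<mu>\<close>)
        then show False using q unfolding fail_def recur_def by simp
      qed
    qed (use meas in measurable)
    also have "\<dots> \<le> Q.prob ?I + Q.prob ?J + Q.prob ?G"
      using meas by (intro order.trans[OF measure_Un_le] add_right_mono order.refl sets.Un)
    also have "Q.prob ?I = prob (fail m (\<rho> * K))" by (rule prob_first[OF fail_sets])
    also have "Q.prob ?J = prob (fail m (\<rho> * K))" by (rule prob_second[OF fail_sets])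
    also have "Q.prob ?G \<le> C / K ^ p" using C(2)[OF Suc.prems] by (simp add: drift_tail_def)
    also have "prob (fail m (\<rho> * K)) \<le> 2 * C / (\<rho> * K) ^ p" using Suc \<rho> by simp
    also have "2 * C / (\<rho> * K) ^ p \<le> (C / K ^ p) / 2"
    proof -
      have "2 * C / (\<rho> * K) ^ p = 2 * (C / K ^ p) / \<rho> ^ p" by (simp add: power_mult_distrib)
      also have "\<dots> \<le> 2 * (C / K ^ p) / 4"
        using p C(1) Suc.prems by (intro divide_left_mono) auto
      finally show ?thesis by simp
    qed
    finally show ?case by simp
  qed
  then show ?thesis using that[of "2 * C" p] C(1) p0 unfolding fail_def by simp
qed

lemma AE_hoelder:
  assumes "\<alpha> < 1"
  shows "AE z in \<mu>. \<exists>n::nat. hoelder_bounded \<alpha> n (fst z)"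
proof -
  \<comment> \<open>A positive exponent is needed for the chaining; the bound for it implies that for \<open>\<alpha>\<close>.\<close>
  define \<beta> where "\<beta> = max \<alpha> (1/2)"
  have \<beta>: "0 < \<beta>" "\<beta> < 1" "\<alpha> \<le> \<beta>" unfolding \<beta>_def using assms by auto
  define a where "a = (2::real) powr - \<beta>"
  have "(2::real) powr - 1 < 2 powr - \<beta>" using \<beta> by (intro powr_less_mono) auto
  then have a: "1/2 < a" unfolding a_def by simp
  from dyadic_failure_bound[OF a] obtain C p where C: "C \<ge> 0" "p \<noteq> 0"
    and fail: "\<And>m K. K > 0 \<Longrightarrow> prob {z \<in> space \<mu>. \<not> dyadic_bounded a m K (fst z)} \<le> C / K ^ p" by blast
  define bad where "bad K = {z \<in> space \<mu>. \<exists>m. \<not> dyadic_bounded a m K (fst z)}" for K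
  have bad_sets [measurable]: "bad K \<in> sets \<mu>" for K unfolding bad_def by measurable
  have bad_le: "prob (bad K) \<le> C / K ^ p" if K: "K > 0" for K
  proof -
    have "(\<lambda>m. prob {z \<in> space \<mu>. \<not> dyadic_bounded a m K (fst z)})
        \<longlonglongrightarrow> prob (\<Union>m. {z \<in> space \<mu>. \<not> dyadic_bounded a m K (fst z)})"
      by (intro finite_Lim_measure_incseq) (auto simp: incseq_def dest: dyadic_bounded_antimono)
    moreover have "(\<Union>m. {z \<in> space \<mu>. \<not> dyadic_bounded a m K (fst z)}) = bad K"
      unfolding bad_def by auto
    ultimately show ?thesis using fail[OF K] by (intro LIMSEQ_le_const2) auto
  qed
  have "prob (\<Inter>n. bad (real (Suc n))) \<le> 0"
  proof (rule LIMSEQ_le_const)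
    have "(\<lambda>n. C * inverse (real (Suc n)) ^ p) \<longlonglongrightarrow> C * 0 ^ p"
      by (intro tendsto_intros LIMSEQ_inverse_real_of_nat)
    moreover have "C * inverse (real (Suc n)) ^ p = C / real (Suc n) ^ p" for n
      by (simp add: divide_inverse power_inverse)
    moreover have "C * 0 ^ p = 0" using C(2) by (simp add: power_0_left)
    ultimately show "(\<lambda>n. C / real (Suc n) ^ p) \<longlonglongrightarrow> 0" by simp
    have "prob (\<Inter>n. bad (real (Suc n))) \<le> C / real (Suc n) ^ p" for n
      by (rule order.trans[OF finite_measure_mono bad_le]) auto
    then show "\<exists>N. \<forall>n\<ge>N. prob (\<Inter>n. bad (real (Suc n))) \<le> C / real (Suc n) ^ p" by blast
  qed
  then have "prob (\<Inter>n. bad (real (Suc n))) = 0" by (simp add: order.antisym)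
  then have "AE z in \<mu>. z \<notin> (\<Inter>n. bad (real (Suc n)))"
    by (intro AE_not_in) (auto simp: null_sets_def emeasure_eq_measure)
  then show ?thesis
    using AE_space
  proof eventually_elim
    case (elim z)
    then obtain n where "\<And>m. dyadic_bounded a m (real (Suc n)) (fst z)"
      unfolding bad_def by auto
    from dyadic_imp_hoelder[OF \<beta>(1) this[unfolded a_def]] obtain L :: nat where "hoelder_bounded \<beta> L (fst z)"
      by auto
    from hoelder_bounded_mono[OF this \<beta>(3)] show ?case by auto
  qed
qed

end

section \<open>The largest slope of a path\<close>

text \<open>
  Lipschitz continuity on the unit interval. Integral constants suffice and make the set of such
  paths a countable union of closed sets.
\<close>

definition lipschitz_path :: "(real \<Rightarrow>\<^sub>C real) \<Rightarrow> bool" where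
  "lipschitz_path f \<longleftrightarrow> (\<exists>n::nat. hoelder_bounded 1 n f)"

text \<open>
  The supremum of the (signed) difference quotients on the unit interval, with the default value zero
  for paths without a Lipschitz bound.
\<close>

definition max_slope :: "(real \<Rightarrow>\<^sub>C real) \<Rightarrow> real" where
  "max_slope f = (if lipschitz_path f then
     SUP (s, t) \<in> {(s, t). 0 \<le> s \<and> s < t \<and> t \<le> 1}. (apply_bcontfun f t - apply_bcontfun f s) / (t - s)
   else 0)"

lemma lipschitz_pathI:
  assumes "\<And>s t. 0 \<le> s \<Longrightarrow> s < t \<Longrightarrow> t \<le> 1 \<Longrightarrow> \<bar>apply_bcontfun f t - apply_bcontfun f s\<bar> \<le> K * (t - s)"
  shows "lipschitz_path f"
proof -
  obtain n :: nat where "K \<le> real n" using real_arch_simple by blast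
  have "\<bar>apply_bcontfun f t - apply_bcontfun f s\<bar> \<le> n * (t - s)" if "0 \<le> s" "s < t" "t \<le> 1" for s t :: real
    by (rule order.trans[OF assms mult_right_mono]) (use that \<open>K \<le> real n\<close> in auto)
  then have "hoelder_bounded 1 n f" unfolding hoelder_bounded_def by simp
  then show ?thesis unfolding lipschitz_path_def ..
qed

lemma lipschitz_pathE:
  assumes "lipschitz_path f"
  obtains K where "K \<ge> 0"
    "\<And>s t. 0 \<le> s \<Longrightarrow> s < t \<Longrightarrow> t \<le> 1 \<Longrightarrow> \<bar>apply_bcontfun f t - apply_bcontfun f s\<bar> \<le> K * (t - s)"
proof -
  obtain n :: nat where n: "hoelder_bounded 1 n f" using assms unfolding lipschitz_path_def ..
  have "\<bar>apply_bcontfun f t - apply_bcontfun f s\<bar> \<le> real n * (t - s)" if "0 \<le> s" "s < t" "t \<le> 1" for s t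
    using n that unfolding hoelder_bounded_def by fastforce
  then show ?thesis using that[of n] by simp
qed

lemma slope_le_max_slope:
  assumes f: "lipschitz_path f" and st: "0 \<le> s" "s < t" "t \<le> 1"
  shows "(apply_bcontfun f t - apply_bcontfun f s) / (t - s) \<le> max_slope f"
proof -
  obtain K where K: "\<And>s t. 0 \<le> s \<Longrightarrow> s < t \<Longrightarrow> t \<le> 1 \<Longrightarrow>
      \<bar>apply_bcontfun f t - apply_bcontfun f s\<bar> \<le> K * (t - s)"
    using lipschitz_pathE[OF f] by blast
  have "bdd_above ((\<lambda>(s, t). (apply_bcontfun f t - apply_bcontfun f s) / (t - s))
      ` {(s, t). 0 \<le> s \<and> s < t \<and> t \<le> 1})"
  proof (rule bdd_aboveI2, clarify)
    fix s t :: real assume "0 \<le> s" "s < t" "t \<le> 1"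
    then show "(apply_bcontfun f t - apply_bcontfun f s) / (t - s) \<le> K"
      using K[of s t] by (simp add: pos_divide_le_eq)
  qed
  from cSUP_upper[OF _ this, of "(s, t)"] show ?thesis using f st by (simp add: max_slope_def)
qed

lemma max_slope_le:
  assumes "lipschitz_path f"
    and "\<And>s t. 0 \<le> s \<Longrightarrow> s < t \<Longrightarrow> t \<le> 1 \<Longrightarrow> (apply_bcontfun f t - apply_bcontfun f s) / (t - s) \<le> c"
  shows "max_slope f \<le> c"
proof -
  have "(0, 1) \<in> {(s, t). 0 \<le> s \<and> s < t \<and> t \<le> (1::real)}" by simp
  then have "{(s, t). 0 \<le> s \<and> s < t \<and> t \<le> (1::real)} \<noteq> {}" by blast
  then show ?thesis
    unfolding max_slope_def if_P[OF assms(1)] by (rule cSUP_least) (use assms(2) in auto)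
qed

lemma max_slope_nonneg: "f \<in> C00 \<Longrightarrow> 0 \<le> max_slope f"
  using slope_le_max_slope[of f 0 1] by (cases "lipschitz_path f") (auto simp: C00_def max_slope_def)

text \<open>
  Both halves have the slopes of the copies, shifted by \<open>drift q / 2\<close> in opposite directions.
\<close>

lemma
  assumes C00: "fst (fst q) \<in> C00" "fst (fst (snd q)) \<in> C00"
  shows glue_slope_left: "s < t \<Longrightarrow> t \<le> 1 \<Longrightarrow> 0 \<le> s \<Longrightarrow>
      (apply_bcontfun (fst (fst q)) t - apply_bcontfun (fst (fst q)) s) / (t - s) + drift q / 2
      = (apply_bcontfun (glue q) (t / 2) - apply_bcontfun (glue q) (s / 2)) / (t / 2 - s / 2)" (is "_ \<Longrightarrow> _ \<Longrightarrow> _ \<Longrightarrow> ?l = ?L")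
    and glue_slope_right: "s < t \<Longrightarrow> t \<le> 1 \<Longrightarrow> 0 \<le> s \<Longrightarrow>
      (apply_bcontfun (fst (fst (snd q))) t - apply_bcontfun (fst (fst (snd q))) s) / (t - s) - drift q / 2
      = (apply_bcontfun (glue q) ((t + 1) / 2) - apply_bcontfun (glue q) ((s + 1) / 2)) / ((t + 1) / 2 - (s + 1) / 2)" (is "_ \<Longrightarrow> _ \<Longrightarrow> _ \<Longrightarrow> ?r = ?R")
proof -
  assume st: "s < t" "t \<le> 1" "0 \<le> s"
  have phi: "apply_bcontfun phi (t / 2) = t / 4" "apply_bcontfun phi (s / 2) = s / 4"
    "apply_bcontfun phi ((t + 1) / 2) = (1 - t) / 4" "apply_bcontfun phi ((s + 1) / 2) = (1 - s) / 4"
    using st by (auto simp: apply_phi max_def min_def field_simps)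
  have le: "t / 2 \<le> 1/2" "s / 2 \<le> 1/2" "1/2 \<le> (t + 1) / 2" "1/2 \<le> (s + 1) / 2" using st by simp_all
  have arg: "2 * (t / 2) = t" "2 * (s / 2) = s" "2 * ((t + 1) / 2) - 1 = t" "2 * ((s + 1) / 2) - 1 = s"
    by (simp_all add: field_simps)
  show "?l = ?L"
    unfolding glue_left[OF C00 le(1)] glue_left[OF C00 le(2)] arg phi using st by (simp add: field_simps)
  show "?r = ?R"
    unfolding glue_right[OF C00 le(3)] glue_right[OF C00 le(4)] arg phi using st by (simp add: field_simps)
qed

lemma lipschitz_glueD:
  assumes C00: "fst (fst q) \<in> C00" "fst (fst (snd q)) \<in> C00" and "lipschitz_path (glue q)"
  shows "lipschitz_path (fst (fst q))" "lipschitz_path (fst (fst (snd q)))"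
proof -
  obtain K where K: "\<And>s t. 0 \<le> s \<Longrightarrow> s < t \<Longrightarrow> t \<le> 1 \<Longrightarrow>
      \<bar>apply_bcontfun (glue q) t - apply_bcontfun (glue q) s\<bar> \<le> K * (t - s)"
    using lipschitz_pathE[OF assms(3)] by blast
  have quot: "\<bar>(apply_bcontfun (glue q) t - apply_bcontfun (glue q) s) / (t - s)\<bar> \<le> K"
    if "0 \<le> s" "s < t" "t \<le> 1" for s t
    using K[OF that] that by (simp add: abs_divide pos_divide_le_eq)
  have bound: "\<bar>x\<bar> \<le> (K + \<bar>drift q\<bar>) * (t - s)"
    if "\<bar>x / (t - s) + d\<bar> \<le> K" "s < t" "\<bar>d\<bar> \<le> \<bar>drift q\<bar>" for x s t d
  proof -
    have "\<bar>x / (t - s)\<bar> \<le> K + \<bar>drift q\<bar>" using that(1,3) by linarith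
    then show ?thesis using that(2) by (simp add: abs_divide pos_divide_le_eq)
  qed
  show "lipschitz_path (fst (fst q))"
  proof (rule lipschitz_pathI)
    fix s t :: real assume st: "0 \<le> s" "s < t" "t \<le> 1"
    show "\<bar>apply_bcontfun (fst (fst q)) t - apply_bcontfun (fst (fst q)) s\<bar> \<le> (K + \<bar>drift q\<bar>) * (t - s)"
      by (rule bound[of _ _ _ "drift q / 2"], unfold glue_slope_left[OF C00 st(2,3,1)], rule quot)
         (use st in auto)
  qed
  show "lipschitz_path (fst (fst (snd q)))"
  proof (rule lipschitz_pathI)
    fix s t :: real assume st: "0 \<le> s" "s < t" "t \<le> 1"
    have "\<bar>(apply_bcontfun (fst (fst (snd q))) t - apply_bcontfun (fst (fst (snd q))) s) / (t - s) - drift q / 2\<bar> \<le> K"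
      unfolding glue_slope_right[OF C00 st(2,3,1)] by (rule quot) (use st in auto)
    then show "\<bar>apply_bcontfun (fst (fst (snd q))) t - apply_bcontfun (fst (fst (snd q))) s\<bar> \<le> (K + \<bar>drift q\<bar>) * (t - s)"
      by (intro bound[of _ _ _ "- drift q / 2"]) (use st in auto)
  qed
qed

lemma max_slope_glue:
  assumes C00: "fst (fst q) \<in> C00" "fst (fst (snd q)) \<in> C00" and L: "lipschitz_path (glue q)"
  shows "max_slope (fst (fst q)) + drift q / 2 \<le> max_slope (glue q)"
    and "max_slope (fst (fst (snd q))) - drift q / 2 \<le> max_slope (glue q)"
proof -
  have "max_slope (fst (fst q)) \<le> max_slope (glue q) - drift q / 2"
  proof (rule max_slope_le[OF lipschitz_glueD(1)[OF assms]])
    fix s t :: real assume st: "0 \<le> s" "s < t" "t \<le> 1"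
    have "(apply_bcontfun (fst (fst q)) t - apply_bcontfun (fst (fst q)) s) / (t - s) + drift q / 2 \<le> max_slope (glue q)"
      unfolding glue_slope_left[OF C00 st(2,3,1)] by (rule slope_le_max_slope[OF L]) (use st in auto)
    then show "(apply_bcontfun (fst (fst q)) t - apply_bcontfun (fst (fst q)) s) / (t - s) \<le> max_slope (glue q) - drift q / 2"
      by simp
  qed
  then show "max_slope (fst (fst q)) + drift q / 2 \<le> max_slope (glue q)" by simp
  have "max_slope (fst (fst (snd q))) \<le> max_slope (glue q) + drift q / 2"
  proof (rule max_slope_le[OF lipschitz_glueD(2)[OF assms]])
    fix s t :: real assume st: "0 \<le> s" "s < t" "t \<le> 1"
    have "(apply_bcontfun (fst (fst (snd q))) t - apply_bcontfun (fst (fst (snd q))) s) / (t - s) - drift q / 2 \<le> max_slope (glue q)"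
      unfolding glue_slope_right[OF C00 st(2,3,1)] by (rule slope_le_max_slope[OF L]) (use st in auto)
    then show "(apply_bcontfun (fst (fst (snd q))) t - apply_bcontfun (fst (fst (snd q))) s) / (t - s) \<le> max_slope (glue q) + drift q / 2"
      by simp
  qed
  then show "max_slope (fst (fst (snd q))) - drift q / 2 \<le> max_slope (glue q)" by simp
qed


context recursion_fixed_point
begin

section \<open>Absence of a Lipschitz bound\<close>

lemma lipschitz_sets [measurable]: "{z \<in> space \<mu>. lipschitz_path (fst z)} \<in> sets \<mu>"
  unfolding lipschitz_path_def by measurable

text \<open>
  Both independent copies in a Lipschitz glued path are Lipschitz, so the probability is at most its
  own square.
\<close>

lemma lipschitz_zero_one: "prob {z \<in> space \<mu>. lipschitz_path (fst z)} \<in> {0, 1}"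
proof -
  let ?L = "{z \<in> space \<mu>. lipschitz_path (fst z)}"
  have "prob ?L = Q.prob {q \<in> space Q. recur q \<in> ?L}" by (rule prob_recur) (rule lipschitz_sets)
  also have "\<dots> \<le> Q.prob {q \<in> space Q. fst q \<in> ?L \<and> fst (snd q) \<in> ?L}"
  proof (rule Q.finite_measure_mono)
    show "{q \<in> space Q. recur q \<in> ?L} \<subseteq> {q \<in> space Q. fst q \<in> ?L \<and> fst (snd q) \<in> ?L}"
    proof
      fix q assume "q \<in> {q \<in> space Q. recur q \<in> ?L}"
      then have q: "q \<in> space Q" and L: "lipschitz_path (glue q)" by (auto simp: recur_def)
      from q have sp: "fst q \<in> space \<mu>" "fst (snd q) \<in> space \<mu>" by (auto simp: space_Q)
      then have C00: "fst (fst q) \<in> C00" "fst (fst (snd q)) \<in> C00" by (auto simp: space_\<mu>)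
      show "q \<in> {q \<in> space Q. fst q \<in> ?L \<and> fst (snd q) \<in> ?L}"
        using q sp lipschitz_glueD[OF C00 L] by simp
    qed
  qed measurable
  also have "\<dots> = prob ?L * prob ?L" by (rule prob_both) (rule lipschitz_sets)+
  finally have "prob ?L * (1 - prob ?L) \<le> 0" by (simp add: algebra_simps)
  moreover have "prob ?L \<le> 1" "0 \<le> prob ?L" by auto
  ultimately show ?thesis by (auto simp: mult_le_0_iff)
qed

text \<open>
  The copy chosen by \<open>\<xi>\<close>: the left one if \<open>\<xi> \<in> B\<close>, the right one otherwise. As \<open>\<xi>\<close> is independent
  of the copies, the chosen one again has law \<open>\<mu>\<close>.
\<close>

definition select :: "real set \<Rightarrow> innovation \<Rightarrow> point" where
  "select B q = (if snd (snd q) \<in> B then fst q else fst (snd q))"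

lemma select_measurable:
  assumes [measurable]: "B \<in> sets borel"
  shows "select B \<in> measurable Q \<mu>"
  unfolding select_def by measurable

lemma distr_select:
  assumes B: "B \<in> sets borel"
  shows "distr Q \<mu> (select B) = \<mu>"
proof (rule measure_eqI)
  note [measurable] = B select_measurable[OF B]
  fix A assume "A \<in> sets (distr Q \<mu> (select B))"
  then have A [measurable]: "A \<in> sets \<mu>" by simp
  have "select B -` A \<inter> space Q = (A \<times> space \<mu> \<times> B) \<union> (space \<mu> \<times> A \<times> (- B))"
    using sets.sets_into_space[OF A] by (auto simp: select_def space_Q split: if_splits)
  then have "Q.prob (select B -` A \<inter> space Q) = Q.prob (A \<times> space \<mu> \<times> B) + Q.prob (space \<mu> \<times> A \<times> (- B))"
    by (simp, intro Q.finite_measure_Union) (auto simp: sets_Q)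
  also have "\<dots> = prob A * (measure unif B + measure unif (- B))"
    using B by (simp add: prob_rectangle prob_space algebra_simps)
  also have "measure unif (- B) = 1 - measure unif B"
    using U.prob_compl[of B] B by (simp add: Compl_eq_Diff_UNIV)
  finally show "emeasure (distr Q \<mu> (select B)) A = emeasure \<mu> A"
    by (simp add: emeasure_distr Q.emeasure_eq_measure emeasure_eq_measure)
qed simp

lemma max_slope_measurable [measurable]: "(\<lambda>z. max_slope (fst z)) \<in> borel_measurable \<mu>"
  unfolding borel_measurable_iff_le
proof
  fix a :: real
  have "closed {f. \<forall>s t. 0 \<le> s \<longrightarrow> s < t \<longrightarrow> t \<le> 1 \<longrightarrow> (apply_bcontfun f t - apply_bcontfun f s) / (t - s) \<le> a}"
    (is "closed {f. ?\<phi> f}")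
  proof -
    have "{f. ?\<phi> f} = (\<Inter>(s, t)\<in>{(s, t). 0 \<le> s \<and> s < t \<and> t \<le> 1}.
        {f. apply_bcontfun f t - apply_bcontfun f s \<le> a * (t - s)})"
      by (auto simp: pos_divide_le_eq)
    also have "closed \<dots>"
      unfolding case_prod_beta by (intro closed_INT ballI closed_Collect_le continuous_intros continuous_on_eval)
    finally show ?thesis .
  qed
  then have S [measurable]: "{z \<in> space \<mu>. ?\<phi> (fst z)} \<in> sets \<mu>" by (rule closed_evals)
  have "max_slope f \<le> a \<longleftrightarrow> (lipschitz_path f \<and> ?\<phi> f) \<or> (\<not> lipschitz_path f \<and> 0 \<le> a)" for f
  proof (cases "lipschitz_path f")
    case True
    show ?thesis using slope_le_max_slope[OF True] max_slope_le[OF True, of a] True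
      by (meson order.trans)
  qed (simp add: max_slope_def)
  then have "{z \<in> space \<mu>. max_slope (fst z) \<le> a}
      = ({z \<in> space \<mu>. lipschitz_path (fst z)} \<inter> {z \<in> space \<mu>. ?\<phi> (fst z)})
        \<union> (if 0 \<le> a then space \<mu> - {z \<in> space \<mu>. lipschitz_path (fst z)} else {})"
    by auto
  also have "\<dots> \<in> sets \<mu>" using S by (auto intro!: sets.Un sets.Int sets.Diff)
  finally show "{z \<in> space \<mu>. max_slope (fst z) \<le> a} \<in> sets \<mu>" .
qed

text \<open>
  An integrable lower bound for the amount that gluing adds to the slopes of the chosen copy. The
  logarithmic term \<open>\<bar>log \<xi> - log (1 - \<xi>)\<bar> / 2\<close> is replaced by the smaller, bounded jump \<open>1/2\<close> for \<open>\<xi> > 3/4\<close>, where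
  the difference of the logarithms is at least \<open>log 3 \<ge> 1\<close>.
\<close>

definition gain :: "innovation \<Rightarrow> real" where
  "gain q = (snd (select {1/2<..} q) - snd (select {..1/2} q)) / 2 + indicator {3/4<..} (snd (snd q)) / 2"

lemma integrable_select: "B \<in> sets borel \<Longrightarrow> integrable Q (\<lambda>q. snd (select B q))"
  by (rule integrable_distr[OF select_measurable]) (simp_all add: distr_select integrable_snd)

lemma expectation_select: "B \<in> sets borel \<Longrightarrow> Q.expectation (\<lambda>q. snd (select B q)) = 0"
  using integral_distr[OF select_measurable, of B snd] by (simp add: distr_select expectation_snd)

lemma integrable_jump: "integrable Q (\<lambda>q. indicator {3/4<..} (snd (snd q)) :: real)"
  by (rule Q.integrable_const_bound[of _ 1]) (auto simp: indicator_def)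

lemma integrable_gain: "integrable Q gain"
  unfolding gain_def by (intro Bochner_Integration.integrable_add Bochner_Integration.integrable_diff integrable_divide
      integrable_select integrable_jump) auto

lemma expectation_gain: "Q.expectation gain = 1/8"
proof -
  have "Q.expectation (\<lambda>q. indicator {3/4<..} (snd (snd q)) :: real)
      = Q.expectation (indicator {q \<in> space Q. snd (snd q) \<in> {3/4<..}})"
    by (rule Bochner_Integration.integral_cong) (auto simp: indicator_def)
  also have "\<dots> = Q.prob {q \<in> space Q. snd (snd q) \<in> {3/4<..}}" by simp
  also have "\<dots> = measure unif {3/4<..}" by (rule prob_third) simp
  also have "\<dots> = measure lborel {3/4<..<1::real}"
  proof -
    have "{0<..<1} \<inter> {3/4<..} = {3/4<..<1::real}" by auto
    then show ?thesis by (subst measure_unif) auto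
  qed
  also have "\<dots> = 1/4" by simp
  finally have "Q.expectation (\<lambda>q. indicator {3/4<..} (snd (snd q)) :: real) = 1/4" .
  then show ?thesis
    unfolding gain_def
    by (simp add: Bochner_Integration.integral_add integrable_select expectation_select integrable_jump)
qed

lemma select_gain_le:
  assumes q: "q \<in> space Q" and L: "lipschitz_path (glue q)" and \<xi>: "0 < snd (snd q)" "snd (snd q) < 1"
  shows "max_slope (fst (select {1/2<..} q)) + gain q \<le> max_slope (fst (recur q))"
proof -
  let ?\<xi> = "snd (snd q)"
  have C00: "fst (fst q) \<in> C00" "fst (fst (snd q)) \<in> C00" using q by (auto simp: space_Q space_\<mu>)
  show ?thesis
  proof (cases "?\<xi> > 1/2")
    case True
    have "indicator {3/4<..} ?\<xi> \<le> ln ?\<xi> - ln (1 - ?\<xi>)"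
    proof (cases "3/4 < ?\<xi>")
      case big: True
      have "exp 1 * (1 - ?\<xi>) \<le> 3 * (1 - ?\<xi>)" using \<xi> exp_le by (intro mult_right_mono) auto
      also have "\<dots> \<le> ?\<xi>" using big by simp
      finally have "ln (exp 1 * (1 - ?\<xi>)) \<le> ln ?\<xi>" using \<xi> by (subst ln_le_cancel_iff) auto
      then show ?thesis using \<xi> big by (simp add: ln_mult)
    next
      case False
      then show ?thesis using True \<xi> by simp
    qed
    then show ?thesis
      using max_slope_glue(1)[OF C00 L] True unfolding gain_def select_def recur_def drift_def by (simp add: field_simps)
  next
    case False
    have "ln ?\<xi> \<le> ln (1 - ?\<xi>)" using False \<xi> by simp
    then show ?thesis
      using max_slope_glue(2)[OF C00 L] False unfolding gain_def select_def recur_def drift_def by (simp add: field_simps)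
  qed
qed

text \<open>
  Otherwise the largest slope is almost surely finite. It need not be integrable, so it is
  truncated at \<open>n\<close>: truncated slopes have equal expectations before and after gluing, although gluing
  adds at least \<open>gain\<close>, whose effect on the truncated slope is dominated by \<open>\<bar>gain\<bar>\<close> and
  converges to \<open>gain\<close>. Hence \<open>gain\<close> would have a nonpositive expectation.
\<close>

lemma prob_lipschitz: "prob {z \<in> space \<mu>. lipschitz_path (fst z)} = 0"
proof (rule ccontr)
  assume "prob {z \<in> space \<mu>. lipschitz_path (fst z)} \<noteq> 0"
  then have "prob {z \<in> space \<mu>. lipschitz_path (fst z)} = 1" using lipschitz_zero_one by auto
  then have "Q.prob {q \<in> space Q. recur q \<in> {z \<in> space \<mu>. lipschitz_path (fst z)}} = 1"
    using prob_recur[OF lipschitz_sets] by simp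
  then have AE1: "AE q in Q. q \<in> {q \<in> space Q. recur q \<in> {z \<in> space \<mu>. lipschitz_path (fst z)}}"
    by (rule Q.AE_prob_1)
  have "measure unif {0<..<1} = 1" by (subst measure_unif) auto
  then have "Q.prob {q \<in> space Q. snd (snd q) \<in> {0<..<1}} = 1"
    by (subst prob_third) auto
  then have AE2: "AE q in Q. q \<in> {q \<in> space Q. snd (snd q) \<in> {0<..<1}}"
    by (rule Q.AE_prob_1)
  define S where "S q = max_slope (fst (select {1/2<..} q))" for q
  have sel [measurable]: "select {1/2<..} \<in> measurable Q \<mu>" by (rule select_measurable) simp
  have [measurable]: "S \<in> borel_measurable Q" unfolding S_def by measurable
  have gain_meas [measurable]: "gain \<in> borel_measurable Q" using integrable_gain by simp
  define cut where "cut n q = min (real n) (S q + gain q) - min (real n) (S q)" for n q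
  have lim: "(\<lambda>n. cut n q) \<longlonglongrightarrow> gain q" for q
  proof (rule tendsto_eventually)
    obtain N :: nat where N: "max (S q) (S q + gain q) \<le> real N" using real_arch_simple by blast
    show "eventually (\<lambda>n. cut n q = gain q) sequentially"
      using eventually_ge_at_top[of N]
    proof eventually_elim
      case (elim n)
      then have "real N \<le> real n" by simp
      then show ?case using N unfolding cut_def by simp
    qed
  qed
  have dom: "norm (cut n q) \<le> norm (gain q)" for n q
    unfolding cut_def by (auto simp: min_def)
  have conv: "integrable Q (cut n)" "(\<lambda>n. Q.expectation (cut n)) \<longlonglongrightarrow> Q.expectation gain" for n
  proof -
    have [measurable]: "cut n \<in> borel_measurable Q" for n unfolding cut_def by measurable
    have ig: "integrable Q (\<lambda>q. norm (gain q))" using integrable_gain by simp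
    show "integrable Q (cut n)"
      by (rule integrable_dominated_convergence[OF _ _ ig]) (use lim dom in auto)
    show "(\<lambda>n. Q.expectation (cut n)) \<longlonglongrightarrow> Q.expectation gain"
      by (rule integral_dominated_convergence[OF _ _ ig]) (use lim dom in auto)
  qed
  have bounded: "integrable \<mu> (\<lambda>z. min (real n) (max_slope (fst z)))" for n
    by (rule integrable_const_bound[of _ "real n"])
       (auto intro!: AE_I2 simp: space_\<mu> max_slope_nonneg)
  have "Q.expectation (cut n) \<le> 0" for n
  proof -
    let ?m = "\<lambda>z. min (real n) (max_slope (fst z))"
    have int: "integrable Q (\<lambda>q. ?m (recur q))" "integrable Q (\<lambda>q. ?m (select {1/2<..} q))"
      by (rule integrable_distr[of _ _ \<mu>]; simp add: distr_recur distr_select bounded)+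
    have "Q.expectation (cut n) \<le> Q.expectation (\<lambda>q. ?m (recur q) - ?m (select {1/2<..} q))"
    proof (rule integral_mono_AE[OF conv(1) Bochner_Integration.integrable_diff[OF int]])
      show "AE q in Q. cut n q \<le> ?m (recur q) - ?m (select {1/2<..} q)"
        using AE1 AE2
      proof eventually_elim
        case (elim q)
        then have "S q + gain q \<le> max_slope (fst (recur q))"
          unfolding S_def by (intro select_gain_le) (auto simp: recur_def)
        then show ?case unfolding cut_def S_def by auto
      qed
    qed
    also have "\<dots> = Q.expectation (\<lambda>q. ?m (recur q)) - Q.expectation (\<lambda>q. ?m (select {1/2<..} q))"
      by (rule Bochner_Integration.integral_diff[OF int])
    also have "Q.expectation (\<lambda>q. ?m (recur q)) = expectation ?m"
      using integral_distr[of recur Q \<mu> ?m] by (simp add: distr_recur)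
    also have "Q.expectation (\<lambda>q. ?m (select {1/2<..} q)) = expectation ?m"
      using integral_distr[OF sel, of ?m] by (simp add: distr_select)
    finally show ?thesis by simp
  qed
  then have "Q.expectation gain \<le> 0" by (intro LIMSEQ_le_const2[OF conv(2)]) auto
  then show False by (simp add: expectation_gain)
qed

end

section \<open>Smoothness of the limit path\<close>

theorem theorem9:
  fixes P :: "'a measure" and Z :: "'a \<Rightarrow> (real \<Rightarrow>\<^sub>C real) \<times> real"
  assumes "prob_space P"
    and "Z \<in> measurable P S_borel"
    and "distr P S_borel Z \<in> M_set"
    and "Psi (distr P S_borel Z) = distr P S_borel Z"
  shows "measure P {\<omega> \<in> space P.
           (SUP (s, t) \<in> {(s, t). 0 \<le> s \<and> s < t \<and> t \<le> 1}.
              ereal (\<bar>apply_bcontfun (fst (Z \<omega>)) t - apply_bcontfun (fst (Z \<omega>)) s\<bar> / \<bar>t - s\<bar>)) = \<infinity>} = 1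
       \<and> (\<forall>\<alpha>::real. \<alpha> < 1 \<longrightarrow>
         measure P {\<omega> \<in> space P.
           (SUP (s, t) \<in> {(s, t). 0 \<le> s \<and> s < t \<and> t \<le> 1}.
              ereal (\<bar>apply_bcontfun (fst (Z \<omega>)) t - apply_bcontfun (fst (Z \<omega>)) s\<bar> / \<bar>t - s\<bar> powr \<alpha>)) < \<infinity>} = 1)"
proof -
  interpret P: prob_space P by fact
  define \<mu> where "\<mu> = distr P S_borel Z"
  interpret recursion_fixed_point \<mu>
    using assms(3,4) unfolding \<mu>_def[symmetric] by unfold_locales
  have Z: "Z \<in> measurable P \<mu>" using assms(2) by (simp add: \<mu>_def)
  have transfer: "P.prob {\<omega> \<in> space P. R (Z \<omega>)} = prob {z \<in> space \<mu>. R z}"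
    if "{z \<in> space \<mu>. R z} \<in> sets \<mu>" for R
  proof -
    have "prob {z \<in> space \<mu>. R z} = measure (distr P S_borel Z) {z \<in> space \<mu>. R z}"
      by (simp add: \<mu>_def)
    also have "\<dots> = P.prob (Z -` {z \<in> space \<mu>. R z} \<inter> space P)"
      using that assms(2) by (subst measure_distr) (auto simp: sets_\<mu>)
    also have "Z -` {z \<in> space \<mu>. R z} \<inter> space P = {\<omega> \<in> space P. R (Z \<omega>)}"
      using measurable_space[OF Z] by auto
    finally show ?thesis ..
  qed
  have "P.prob {\<omega> \<in> space P. (SUP (s, t) \<in> {(s, t). 0 \<le> s \<and> s < t \<and> t \<le> 1}.
      ereal (\<bar>apply_bcontfun (fst (Z \<omega>)) t - apply_bcontfun (fst (Z \<omega>)) s\<bar> / \<bar>t - s\<bar>)) = \<infinity>} = 1"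
  proof -
    have "(SUP (s, t) \<in> {(s, t). 0 \<le> s \<and> s < t \<and> t \<le> 1}.
        ereal (\<bar>apply_bcontfun f t - apply_bcontfun f s\<bar> / \<bar>t - s\<bar>)) = \<infinity> \<longleftrightarrow> \<not> lipschitz_path f" for f
      using hoelder_SUP_iff[of f 1] unfolding lipschitz_path_def powr_one' abs_idempotent ereal_infty_less by blast
    then have "P.prob {\<omega> \<in> space P. (SUP (s, t) \<in> {(s, t). 0 \<le> s \<and> s < t \<and> t \<le> 1}.
      ereal (\<bar>apply_bcontfun (fst (Z \<omega>)) t - apply_bcontfun (fst (Z \<omega>)) s\<bar> / \<bar>t - s\<bar>)) = \<infinity>}
      = P.prob {\<omega> \<in> space P. \<not> lipschitz_path (fst (Z \<omega>))}" by simp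
    also have "\<dots> = prob {z \<in> space \<mu>. \<not> lipschitz_path (fst z)}"
      by (rule transfer) measurable
    also have "\<dots> = 1" using prob_neg[OF lipschitz_sets] prob_lipschitz by simp
    finally show ?thesis .
  qed
  moreover have "P.prob {\<omega> \<in> space P. (SUP (s, t) \<in> {(s, t). 0 \<le> s \<and> s < t \<and> t \<le> 1}.
      ereal (\<bar>apply_bcontfun (fst (Z \<omega>)) t - apply_bcontfun (fst (Z \<omega>)) s\<bar> / \<bar>t - s\<bar> powr \<alpha>)) < \<infinity>} = 1"
    if "\<alpha> < 1" for \<alpha>
  proof -
    have "P.prob {\<omega> \<in> space P. \<exists>n::nat. hoelder_bounded \<alpha> n (fst (Z \<omega>))}
        = prob {z \<in> space \<mu>. \<exists>n::nat. hoelder_bounded \<alpha> n (fst z)}"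
      by (rule transfer) measurable
    also have "\<dots> = 1" using AE_hoelder[OF that] by (subst prob_Collect_eq_1) auto
    finally show ?thesis unfolding hoelder_SUP_iff .
  qed
  ultimately show ?thesis by blast
qed

end
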